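(* Let $\mathcal{C}$ be a fusion category with pivotal structure $a:\mathrm{id}\to(-)^{**}$, let $\overline{a}$ be the conjugate pivotal structure of $a$, and let $g_c:{}^{**}c\to c^{**}$ be the canonical monoidal natural isomorphism of $\mathcal{C}$. (i) $a$ and its conjugate $\overline{a}$ combine to $g$, i.e. $\overline{a}_c\circ a_{{}^{**}c}=a_c\circ\overline{a}_{{}^{**}c}=g_c:{}^{**}c\to c^{**}$ for all $c\in\mathcal{C}$. (ii) $a$ is spherical if and only if $a_c\circ a_{{}^{**}c}=g_c$ for all $c\in\mathcal{C}$.
   Context: A fusion category is a semisimple, rigid, monoidal $\mathbb{C}$-linear abelian category with finite-dimensional Hom spaces, tensor product bilinear on morphisms, simple unit $1$ and finitely many isomorphism classes of simple objects; it is treated as strict. The right dual of $c$ is $c^{*}$ with $\mathrm{ev}_c:c^{*}\otimes c\to1$, $\mathrm{coev}_c:1\to c\otimes c^{*}$; the left dual is ${}^{*}c$ with $\mathrm{ev}'_c:c\otimes{}^{*}c\to1$, $\mathrm{coev}'_c:1\to{}^{*}c\otimes c$. Canonical isomorphisms $({}^{*}c)^{*}\cong c\cong{}^{*}(c^{*})$ are treated as identities, so $({}^{**}c)^{**}=c$. A pivotal structure is a monoidal natural isomorphism $a:\mathrm{id}\to(-)^{**}$. The left trace of $f\in\mathrm{End}(c)$ is $\mathrm{tr}^{L}_c(f)=\mathrm{ev}_c\circ(a_{{}^{*}c}\otimes f)\circ\mathrm{coev}'_c\in\mathbb{C}$, the right trace is $\mathrm{ev}_{c^{*}}\circ((a_c\circ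 f)\otimes\mathrm{id}_{c^{*}})\circ\mathrm{coev}_c$; $a$ is spherical if these agree for all endomorphisms. The conjugate pivotal structure $\overline{a}$ is the pivotal structure determined by $$\mathrm{tr}^{L}_{c}\bigl(g\circ(\mathrm{id}_d\otimes(\overline{a}_{{}^{**}x})^{-1})\circ f\bigr)=\mathrm{tr}^{L}_{d}\bigl((\mathrm{id}_d\otimes\mathrm{ev}'_x)\circ((f\circ g)\otimes\mathrm{id}_{{}^{*}x})\circ(\mathrm{id}_d\otimes\mathrm{coev}'_{{}^{*}x})\bigr)$$ for all $c,d,x$, all $f\in\mathrm{Hom}(c,d\otimes x)$ and $g\in\mathrm{Hom}(d\otimes{}^{**}x,c)$ (left traces with respect to $a$). The monoidal natural isomorphism $g_c:{}^{**}c\to c^{**}$ is uniquely determined by the requirement that $\mathrm{ev}_{c^{*}}\circ((g_c\circ f\circ h)\otimes\mathrm{id}_{c^{*}})\circ\mathrm{coev}_c=\mathrm{ev}'_{{}^{*}c}\circ(\mathrm{id}_{{}^{*}c}\otimes(f\circ h))\circ\mathrm{coev}'_c$ for all $x\in\mathcal{C}$, $f\in\mathrm{Hom}(x,{}^{**}c)$, $h\in\mathrm{Hom}(c,x)$. *)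

theory Defs
  imports Complex_Main
begin

section \<open>Linear categories with tensor product and duals: the data\<close>

text \<open>
  Objects are the elements of the type \<open>'o\<close>. Morphisms live in one ambient complex vector space
  \<open>'m\<close> (addition is that of the type, the scalar action is the record field \<open>scale\<close>), and
  every \<open>Hom c d\<close> is a linear subspace of it. This loses no generality: take for \<open>'m\<close> the direct sum of all
  Hom spaces. As \<open>0\<close> lies in every Hom space, a morphism does not determine its source and target;
  operations that depend on them take them as arguments.

  Duals are chosen: \<open>rdual c\<close> is $c^{*}$ with \<open>ev\<close>, \<open>coev\<close>, and \<open>ldual c\<close> is ${}^{*}c$ with
  \<open>lev\<close> = $\mathrm{ev}'$, \<open>lcoev\<close> = $\mathrm{coev}'$.
\<close>

record ('o, 'm) tensor_cat =
  Hom    :: "'o \<Rightarrow> 'o \<Rightarrow> 'm set"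
  ide    :: "'o \<Rightarrow> 'm"  ("idm\<index>")
  comp   :: "'m \<Rightarrow> 'm \<Rightarrow> 'm"  (infixr "\<cdot>\<index>" 70)
  scale  :: "complex \<Rightarrow> 'm \<Rightarrow> 'm"
  tobj   :: "'o \<Rightarrow> 'o \<Rightarrow> 'o"  (infixr "\<odot>\<index>" 80)
  tmor   :: "'m \<Rightarrow> 'm \<Rightarrow> 'm"  (infixr "\<otimes>\<index>" 80)
  tunit  :: "'o"  ("\<one>\<index>")
  rdual  :: "'o \<Rightarrow> 'o"
  ev     :: "'o \<Rightarrow> 'm"
  coev   :: "'o \<Rightarrow> 'm"
  ldual  :: "'o \<Rightarrow> 'o"
  lev    :: "'o \<Rightarrow> 'm"
  lcoev  :: "'o \<Rightarrow> 'm"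

section \<open>Notions for linear and abelian categories\<close>

definition is_inverse ::
    "('o, 'm, 'x) tensor_cat_scheme \<Rightarrow> 'o \<Rightarrow> 'o \<Rightarrow> 'm \<Rightarrow> 'm \<Rightarrow> bool"
  where "is_inverse C c d f h \<longleftrightarrow> f \<in> Hom C c d \<and> h \<in> Hom C d c \<and>
    h \<cdot>\<^bsub>C\<^esub> f = idm\<^bsub>C\<^esub> c \<and> f \<cdot>\<^bsub>C\<^esub> h = idm\<^bsub>C\<^esub> d"

definition is_iso :: "('o, 'm, 'x) tensor_cat_scheme \<Rightarrow> 'o \<Rightarrow> 'o \<Rightarrow> 'm \<Rightarrow> bool"
  where "is_iso C c d f \<longleftrightarrow> (\<exists>h. is_inverse C c d f h)"

definition inverse_mor :: "('o, 'm, 'x) tensor_cat_scheme \<Rightarrow> 'o \<Rightarrow> 'o \<Rightarrow> 'm \<Rightarrow> 'm"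
  where "inverse_mor C c d f = (THE h. is_inverse C c d f h)"

definition isomorphic :: "('o, 'm, 'x) tensor_cat_scheme \<Rightarrow> 'o \<Rightarrow> 'o \<Rightarrow> bool"
  where "isomorphic C c d \<longleftrightarrow> (\<exists>f. is_iso C c d f)"

definition is_mono :: "('o, 'm, 'x) tensor_cat_scheme \<Rightarrow> 'o \<Rightarrow> 'o \<Rightarrow> 'm \<Rightarrow> bool"
  where "is_mono C c d f \<longleftrightarrow> f \<in> Hom C c d \<and>
    (\<forall>x. \<forall>u \<in> Hom C x c. \<forall>v \<in> Hom C x c. f \<cdot>\<^bsub>C\<^esub> u = f \<cdot>\<^bsub>C\<^esub> v \<longrightarrow> u = v)"

definition is_epi :: "('o, 'm, 'x) tensor_cat_scheme \<Rightarrow> 'o \<Rightarrow> 'o \<Rightarrow> 'm \<Rightarrow> bool"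
  where "is_epi C c d f \<longleftrightarrow> f \<in> Hom C c d \<and>
    (\<forall>x. \<forall>u \<in> Hom C d x. \<forall>v \<in> Hom C d x. u \<cdot>\<^bsub>C\<^esub> f = v \<cdot>\<^bsub>C\<^esub> f \<longrightarrow> u = v)"

definition is_zero_obj :: "('o, 'm, 'x) tensor_cat_scheme \<Rightarrow> 'o \<Rightarrow> bool"
  where "is_zero_obj C z \<longleftrightarrow> (\<forall>c. (\<exists>!f. f \<in> Hom C z c) \<and> (\<exists>!f. f \<in> Hom C c z))"

definition is_kernel ::
    "('o, 'm::ab_group_add, 'x) tensor_cat_scheme \<Rightarrow> 'o \<Rightarrow> 'o \<Rightarrow> 'm \<Rightarrow> 'o \<Rightarrow> 'm \<Rightarrow> bool"
  where "is_kernel C c d f k i \<longleftrightarrow> i \<in> Hom C k c \<and> f \<cdot>\<^bsub>C\<^esub> i = 0 \<and>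
    (\<forall>x. \<forall>u \<in> Hom C x c. f \<cdot>\<^bsub>C\<^esub> u = 0 \<longrightarrow> (\<exists>!v. v \<in> Hom C x k \<and> i \<cdot>\<^bsub>C\<^esub> v = u))"

definition is_cokernel ::
    "('o, 'm::ab_group_add, 'x) tensor_cat_scheme \<Rightarrow> 'o \<Rightarrow> 'o \<Rightarrow> 'm \<Rightarrow> 'o \<Rightarrow> 'm \<Rightarrow> bool"
  where "is_cokernel C c d f k p \<longleftrightarrow> p \<in> Hom C d k \<and> p \<cdot>\<^bsub>C\<^esub> f = 0 \<and>
    (\<forall>x. \<forall>u \<in> Hom C d x. u \<cdot>\<^bsub>C\<^esub> f = 0 \<longrightarrow> (\<exists>!v. v \<in> Hom C k x \<and> v \<cdot>\<^bsub>C\<^esub> p = u))"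

definition is_direct_sum ::
    "('o, 'm::ab_group_add, 'x) tensor_cat_scheme \<Rightarrow> 'o list \<Rightarrow> 'o \<Rightarrow> bool"
  where "is_direct_sum C xs y \<longleftrightarrow> (\<exists>i p.
    (\<forall>k < length xs. i k \<in> Hom C (xs ! k) y \<and> p k \<in> Hom C y (xs ! k)) \<and>
    (\<forall>j < length xs. \<forall>k < length xs.
        p j \<cdot>\<^bsub>C\<^esub> i k = (if j = k then idm\<^bsub>C\<^esub> (xs ! k) else 0)) \<and>
    (\<Sum>k < length xs. i k \<cdot>\<^bsub>C\<^esub> p k) = idm\<^bsub>C\<^esub> y)"

definition is_simple :: "('o, 'm, 'x) tensor_cat_scheme \<Rightarrow> 'o \<Rightarrow> bool"
  where "is_simple C s \<longleftrightarrow> \<not> is_zero_obj C s \<and>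
    (\<forall>x i. is_mono C x s i \<longrightarrow> is_zero_obj C x \<or> is_iso C x s i)"

section \<open>Fusion categories\<close>

locale linear_category = vector_space "scale C"
  for C :: "('o, 'm::ab_group_add, 'x) tensor_cat_scheme" (structure) +
  assumes Hom_subspace: "subspace (Hom C c d)"
    and ide_in_Hom: "idm c \<in> Hom C c c"
    and comp_in_Hom: "\<lbrakk>h \<in> Hom C d e; f \<in> Hom C c d\<rbrakk> \<Longrightarrow> h \<cdot> f \<in> Hom C c e"
    and ide_comp: "f \<in> Hom C c d \<Longrightarrow> idm d \<cdot> f = f"
    and comp_ide: "f \<in> Hom C c d \<Longrightarrow> f \<cdot> idm c = f"
    and comp_assoc: "\<lbrakk>k \<in> Hom C d e; h \<in> Hom C c d; f \<in> Hom C b c\<rbrakk>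
      \<Longrightarrow> (k \<cdot> h) \<cdot> f = k \<cdot> (h \<cdot> f)"
    and comp_add_left: "\<lbrakk>h \<in> Hom C d e; h' \<in> Hom C d e; f \<in> Hom C c d\<rbrakk>
      \<Longrightarrow> (h + h') \<cdot> f = h \<cdot> f + h' \<cdot> f"
    and comp_add_right: "\<lbrakk>h \<in> Hom C d e; f \<in> Hom C c d; f' \<in> Hom C c d\<rbrakk>
      \<Longrightarrow> h \<cdot> (f + f') = h \<cdot> f + h \<cdot> f'"
    and comp_scale_left: "\<lbrakk>h \<in> Hom C d e; f \<in> Hom C c d\<rbrakk>
      \<Longrightarrow> scale C z h \<cdot> f = scale C z (h \<cdot> f)"
    and comp_scale_right: "\<lbrakk>h \<in> Hom C d e; f \<in> Hom C c d\<rbrakk>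
      \<Longrightarrow> h \<cdot> scale C z f = scale C z (h \<cdot> f)"

locale abelian_linear_category = linear_category +
  assumes ex_zero_obj: "\<exists>z. is_zero_obj C z"
    and ex_biproduct: "\<exists>y. is_direct_sum C [c, d] y"
    and ex_kernel: "f \<in> Hom C c d \<Longrightarrow> \<exists>k i. is_kernel C c d f k i"
    and ex_cokernel: "f \<in> Hom C c d \<Longrightarrow> \<exists>k p. is_cokernel C c d f k p"
    and mono_is_kernel: "is_mono C c d f \<Longrightarrow> \<exists>e h. h \<in> Hom C d e \<and> is_kernel C d e h c f"
    and epi_is_cokernel: "is_epi C c d f \<Longrightarrow> \<exists>b h. h \<in> Hom C b c \<and> is_cokernel C b c h d f"

text \<open>Strict monoidal, with tensor product bilinear on morphisms.\<close>

locale strict_tensor_category = linear_category +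
  assumes tobj_assoc: "(b \<odot> c) \<odot> d = b \<odot> (c \<odot> d)"
    and tobj_unit_left: "\<one> \<odot> c = c"
    and tobj_unit_right: "c \<odot> \<one> = c"
    and tmor_in_Hom: "\<lbrakk>f \<in> Hom C c d; f' \<in> Hom C c' d'\<rbrakk> \<Longrightarrow> f \<otimes> f' \<in> Hom C (c \<odot> c') (d \<odot> d')"
    and tmor_ide: "idm c \<otimes> idm d = idm (c \<odot> d)"
    and tmor_comp: "\<lbrakk>h \<in> Hom C d e; f \<in> Hom C c d; h' \<in> Hom C d' e'; f' \<in> Hom C c' d'\<rbrakk>
      \<Longrightarrow> (h \<cdot> f) \<otimes> (h' \<cdot> f') = (h \<otimes> h') \<cdot> (f \<otimes> f')"
    and tmor_assoc: "\<lbrakk>f \<in> Hom C c d; f' \<in> Hom C c' d'; f'' \<in> Hom C c'' d''\<rbrakk>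
      \<Longrightarrow> (f \<otimes> f') \<otimes> f'' = f \<otimes> (f' \<otimes> f'')"
    and tmor_unit_left: "f \<in> Hom C c d \<Longrightarrow> idm \<one> \<otimes> f = f"
    and tmor_unit_right: "f \<in> Hom C c d \<Longrightarrow> f \<otimes> idm \<one> = f"
    and tmor_add_left: "\<lbrakk>f \<in> Hom C c d; h \<in> Hom C c d; f' \<in> Hom C c' d'\<rbrakk>
      \<Longrightarrow> (f + h) \<otimes> f' = f \<otimes> f' + h \<otimes> f'"
    and tmor_add_right: "\<lbrakk>f \<in> Hom C c d; f' \<in> Hom C c' d'; h' \<in> Hom C c' d'\<rbrakk>
      \<Longrightarrow> f \<otimes> (f' + h') = f \<otimes> f' + f \<otimes> h'"
    and tmor_scale_left: "\<lbrakk>f \<in> Hom C c d; f' \<in> Hom C c' d'\<rbrakk>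
      \<Longrightarrow> scale C z f \<otimes> f' = scale C z (f \<otimes> f')"
    and tmor_scale_right: "\<lbrakk>f \<in> Hom C c d; f' \<in> Hom C c' d'\<rbrakk>
      \<Longrightarrow> f \<otimes> scale C z f' = scale C z (f \<otimes> f')"

text \<open>
  The last four axioms say that the canonical isomorphisms $({}^{*}c)^{*} \to c$ and
  ${}^{*}(c^{*}) \to c$ (comparing two right duals of ${}^{*}c$, resp. two left duals of
  $c^{*}$) are identities.
\<close>

locale rigid_tensor_category = strict_tensor_category +
  assumes ev_in_Hom: "ev C c \<in> Hom C (rdual C c \<odot> c) \<one>"
    and coev_in_Hom: "coev C c \<in> Hom C \<one> (c \<odot> rdual C c)"
    and lev_in_Hom: "lev C c \<in> Hom C (c \<odot> ldual C c) \<one>"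
    and lcoev_in_Hom: "lcoev C c \<in> Hom C \<one> (ldual C c \<odot> c)"
    and rdual_snake1: "(idm c \<otimes> ev C c) \<cdot> (coev C c \<otimes> idm c) = idm c"
    and rdual_snake2:
      "(ev C c \<otimes> idm (rdual C c)) \<cdot> (idm (rdual C c) \<otimes> coev C c) = idm (rdual C c)"
    and ldual_snake1: "(lev C c \<otimes> idm c) \<cdot> (idm c \<otimes> lcoev C c) = idm c"
    and ldual_snake2:
      "(idm (ldual C c) \<otimes> lev C c) \<cdot> (lcoev C c \<otimes> idm (ldual C c)) = idm (ldual C c)"
    and rdual_ldual: "rdual C (ldual C c) = c"
    and ldual_rdual: "ldual C (rdual C c) = c"
    and canonical_rdual_ldual:
      "(ev C (ldual C c) \<otimes> idm c) \<cdot> (idm (rdual C (ldual C c)) \<otimes> lcoev C c) = idm c"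
    and canonical_ldual_rdual:
      "(idm c \<otimes> lev C (rdual C c)) \<cdot> (coev C c \<otimes> idm (ldual C (rdual C c))) = idm c"

locale fusion_category = abelian_linear_category + rigid_tensor_category +
  assumes Hom_finite_dim: "\<exists>B. finite B \<and> B \<subseteq> Hom C c d \<and> Hom C c d \<subseteq> span B"
    and semisimple: "\<exists>xs. (\<forall>s \<in> set xs. is_simple C s) \<and> is_direct_sum C xs y"
    and simple_unit: "is_simple C \<one>"
    and finitely_many_simples:
      "\<exists>S. finite S \<and> (\<forall>s. is_simple C s \<longrightarrow> (\<exists>t \<in> S. isomorphic C s t))"

section \<open>The double dual functors\<close>

text \<open>
  For \<open>f \<in> Hom c d\<close>: $f^{*} : d^{*} \to c^{*}$ and ${}^{*}f : {}^{*}d \to {}^{*}c$.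
\<close>

definition rdual_mor :: "('o, 'm, 'x) tensor_cat_scheme \<Rightarrow> 'o \<Rightarrow> 'o \<Rightarrow> 'm \<Rightarrow> 'm"
  where "rdual_mor C c d f =
    (ev C d \<otimes>\<^bsub>C\<^esub> idm\<^bsub>C\<^esub> (rdual C c))
    \<cdot>\<^bsub>C\<^esub> (idm\<^bsub>C\<^esub> (rdual C d) \<otimes>\<^bsub>C\<^esub> f \<otimes>\<^bsub>C\<^esub> idm\<^bsub>C\<^esub> (rdual C c))
    \<cdot>\<^bsub>C\<^esub> (idm\<^bsub>C\<^esub> (rdual C d) \<otimes>\<^bsub>C\<^esub> coev C c)"

definition ldual_mor :: "('o, 'm, 'x) tensor_cat_scheme \<Rightarrow> 'o \<Rightarrow> 'o \<Rightarrow> 'm \<Rightarrow> 'm"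
  where "ldual_mor C c d f =
    (idm\<^bsub>C\<^esub> (ldual C c) \<otimes>\<^bsub>C\<^esub> lev C d)
    \<cdot>\<^bsub>C\<^esub> (idm\<^bsub>C\<^esub> (ldual C c) \<otimes>\<^bsub>C\<^esub> f \<otimes>\<^bsub>C\<^esub> idm\<^bsub>C\<^esub> (ldual C d))
    \<cdot>\<^bsub>C\<^esub> (lcoev C c \<otimes>\<^bsub>C\<^esub> idm\<^bsub>C\<^esub> (ldual C d))"

text \<open>
  The canonical isomorphisms $d^{*} \otimes c^{*} \to (c \otimes d)^{*}$ and
  ${}^{*}d \otimes {}^{*}c \to {}^{*}(c \otimes d)$; in contrast to $({}^{*}c)^{*} = c$ they are
  not assumed to be identities.
\<close>

definition rdual_tensor :: "('o, 'm, 'x) tensor_cat_scheme \<Rightarrow> 'o \<Rightarrow> 'o \<Rightarrow> 'm"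
  where "rdual_tensor C c d =
    ((ev C d \<cdot>\<^bsub>C\<^esub> (idm\<^bsub>C\<^esub> (rdual C d) \<otimes>\<^bsub>C\<^esub> ev C c \<otimes>\<^bsub>C\<^esub> idm\<^bsub>C\<^esub> d))
      \<otimes>\<^bsub>C\<^esub> idm\<^bsub>C\<^esub> (rdual C (c \<odot>\<^bsub>C\<^esub> d)))
    \<cdot>\<^bsub>C\<^esub> (idm\<^bsub>C\<^esub> (rdual C d \<odot>\<^bsub>C\<^esub> rdual C c) \<otimes>\<^bsub>C\<^esub> coev C (c \<odot>\<^bsub>C\<^esub> d))"

definition ldual_tensor :: "('o, 'm, 'x) tensor_cat_scheme \<Rightarrow> 'o \<Rightarrow> 'o \<Rightarrow> 'm"
  where "ldual_tensor C c d =
    (idm\<^bsub>C\<^esub> (ldual C (c \<odot>\<^bsub>C\<^esub> d))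
      \<otimes>\<^bsub>C\<^esub> (lev C c \<cdot>\<^bsub>C\<^esub> (idm\<^bsub>C\<^esub> c \<otimes>\<^bsub>C\<^esub> lev C d \<otimes>\<^bsub>C\<^esub> idm\<^bsub>C\<^esub> (ldual C c))))
    \<cdot>\<^bsub>C\<^esub> (lcoev C (c \<odot>\<^bsub>C\<^esub> d) \<otimes>\<^bsub>C\<^esub> idm\<^bsub>C\<^esub> (ldual C d \<odot>\<^bsub>C\<^esub> ldual C c))"

text \<open>
  Data of a monoidal endofunctor \<open>F\<close>: \<open>fmor F c d f\<close> is the image of \<open>f \<in> Hom c d\<close>,
  \<open>ften F c d\<close> the structure isomorphism $F c \otimes F d \to F(c \otimes d)$ and \<open>fone F\<close>
  the structure isomorphism $1 \to F 1$.
\<close>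

record ('o, 'm) monoidal_functor =
  fobj :: "'o \<Rightarrow> 'o"
  fmor :: "'o \<Rightarrow> 'o \<Rightarrow> 'm \<Rightarrow> 'm"
  ften :: "'o \<Rightarrow> 'o \<Rightarrow> 'm"
  fone :: "'m"

definition monoidal_nat_iso ::
    "('o, 'm, 'x) tensor_cat_scheme \<Rightarrow> ('o, 'm) monoidal_functor \<Rightarrow> ('o, 'm) monoidal_functor
      \<Rightarrow> ('o \<Rightarrow> 'm) \<Rightarrow> bool"
  where "monoidal_nat_iso C F G a \<longleftrightarrow>
    (\<forall>c. is_iso C (fobj F c) (fobj G c) (a c)) \<and>
    (\<forall>c d. \<forall>f \<in> Hom C c d. fmor G c d f \<cdot>\<^bsub>C\<^esub> a c = a d \<cdot>\<^bsub>C\<^esub> fmor F c d f) \<and>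
    (\<forall>c d. ften G c d \<cdot>\<^bsub>C\<^esub> (a c \<otimes>\<^bsub>C\<^esub> a d) = a (c \<odot>\<^bsub>C\<^esub> d) \<cdot>\<^bsub>C\<^esub> ften F c d) \<and>
    a \<one>\<^bsub>C\<^esub> \<cdot>\<^bsub>C\<^esub> fone F = fone G"

definition id_functor :: "('o, 'm, 'x) tensor_cat_scheme \<Rightarrow> ('o, 'm) monoidal_functor"
  where "id_functor C =
    \<lparr> fobj = (\<lambda>c. c),
      fmor = (\<lambda>c d f. f),
      ften = (\<lambda>c d. idm\<^bsub>C\<^esub> (c \<odot>\<^bsub>C\<^esub> d)),
      fone = idm\<^bsub>C\<^esub> \<one>\<^bsub>C\<^esub> \<rparr>"

text \<open>
  The functor $(-)^{**}$. Its structure isomorphisms are the composites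
  $c^{**} \otimes d^{**} \to (d^{*} \otimes c^{*})^{*} \to (c \otimes d)^{**}$ and
  $1 \to 1^{*} \to 1^{**}$; note that $\mathrm{coev}_1 : 1 \to 1^{*}$ is
  the canonical isomorphism, with inverse $\mathrm{ev}_1$. The functor ${}^{**}(-)$ below is
  analogous.
\<close>

definition rddual :: "('o, 'm, 'x) tensor_cat_scheme \<Rightarrow> ('o, 'm) monoidal_functor"
  where "rddual C =
    \<lparr> fobj = (\<lambda>c. rdual C (rdual C c)),
      fmor = (\<lambda>c d f. rdual_mor C (rdual C d) (rdual C c) (rdual_mor C c d f)),
      ften = (\<lambda>c d.
        rdual_mor C (rdual C (c \<odot>\<^bsub>C\<^esub> d)) (rdual C d \<odot>\<^bsub>C\<^esub> rdual C c)
          (inverse_mor C (rdual C d \<odot>\<^bsub>C\<^esub> rdual C c) (rdual C (c \<odot>\<^bsub>C\<^esub> d)) (rdual_tensor C c d))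
        \<cdot>\<^bsub>C\<^esub> rdual_tensor C (rdual C d) (rdual C c)),
      fone = rdual_mor C (rdual C \<one>\<^bsub>C\<^esub>) \<one>\<^bsub>C\<^esub> (ev C \<one>\<^bsub>C\<^esub>) \<cdot>\<^bsub>C\<^esub> coev C \<one>\<^bsub>C\<^esub> \<rparr>"

definition lddual :: "('o, 'm, 'x) tensor_cat_scheme \<Rightarrow> ('o, 'm) monoidal_functor"
  where "lddual C =
    \<lparr> fobj = (\<lambda>c. ldual C (ldual C c)),
      fmor = (\<lambda>c d f. ldual_mor C (ldual C d) (ldual C c) (ldual_mor C c d f)),
      ften = (\<lambda>c d.
        ldual_mor C (ldual C (c \<odot>\<^bsub>C\<^esub> d)) (ldual C d \<odot>\<^bsub>C\<^esub> ldual C c)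
          (inverse_mor C (ldual C d \<odot>\<^bsub>C\<^esub> ldual C c) (ldual C (c \<odot>\<^bsub>C\<^esub> d)) (ldual_tensor C c d))
        \<cdot>\<^bsub>C\<^esub> ldual_tensor C (ldual C d) (ldual C c)),
      fone = ldual_mor C (ldual C \<one>\<^bsub>C\<^esub>) \<one>\<^bsub>C\<^esub> (lev C \<one>\<^bsub>C\<^esub>) \<cdot>\<^bsub>C\<^esub> lcoev C \<one>\<^bsub>C\<^esub> \<rparr>"

section \<open>Pivotal structures, traces, sphericality\<close>

definition pivotal_structure ::
    "('o, 'm, 'x) tensor_cat_scheme \<Rightarrow> ('o \<Rightarrow> 'm) \<Rightarrow> bool"
  where "pivotal_structure C a \<longleftrightarrow> monoidal_nat_iso C (id_functor C) (rddual C) a"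

text \<open>
  The identification of $\mathrm{End}(1)$ with the complex numbers; well defined since \<open>1\<close> is simple.
\<close>

definition scalar_of :: "('o, 'm, 'x) tensor_cat_scheme \<Rightarrow> 'm \<Rightarrow> complex"
  where "scalar_of C u = (THE z. u = scale C z (idm\<^bsub>C\<^esub> \<one>\<^bsub>C\<^esub>))"

definition left_trace ::
    "('o, 'm, 'x) tensor_cat_scheme \<Rightarrow> ('o \<Rightarrow> 'm) \<Rightarrow> 'o \<Rightarrow> 'm \<Rightarrow> complex"
  where "left_trace C a c f =
    scalar_of C (ev C c \<cdot>\<^bsub>C\<^esub> (a (ldual C c) \<otimes>\<^bsub>C\<^esub> f) \<cdot>\<^bsub>C\<^esub> lcoev C c)"

definition right_trace ::
    "('o, 'm, 'x) tensor_cat_scheme \<Rightarrow> ('o \<Rightarrow> 'm) \<Rightarrow> 'o \<Rightarrow> 'm \<Rightarrow> complex"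
  where "right_trace C a c f =
    scalar_of C (ev C (rdual C c)
      \<cdot>\<^bsub>C\<^esub> ((a c \<cdot>\<^bsub>C\<^esub> f) \<otimes>\<^bsub>C\<^esub> idm\<^bsub>C\<^esub> (rdual C c)) \<cdot>\<^bsub>C\<^esub> coev C c)"

definition spherical :: "('o, 'm, 'x) tensor_cat_scheme \<Rightarrow> ('o \<Rightarrow> 'm) \<Rightarrow> bool"
  where "spherical C a \<longleftrightarrow> (\<forall>c. \<forall>f \<in> Hom C c c. left_trace C a c f = right_trace C a c f)"

text \<open>
  \<open>b\<close> is the conjugate of \<open>a\<close>. Here $b_{{}^{**}x} : {}^{**}x \to ({}^{**}x)^{**} = x$.
\<close>

definition conjugate_pivotal ::
    "('o, 'm, 'x) tensor_cat_scheme \<Rightarrow> ('o \<Rightarrow> 'm) \<Rightarrow> ('o \<Rightarrow> 'm) \<Rightarrow> bool"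
  where "conjugate_pivotal C a b \<longleftrightarrow> pivotal_structure C b \<and>
    (\<forall>c d x. \<forall>f \<in> Hom C c (d \<odot>\<^bsub>C\<^esub> x). \<forall>h \<in> Hom C (d \<odot>\<^bsub>C\<^esub> ldual C (ldual C x)) c.
      left_trace C a c
        (h \<cdot>\<^bsub>C\<^esub> (idm\<^bsub>C\<^esub> d \<otimes>\<^bsub>C\<^esub> inverse_mor C (ldual C (ldual C x)) x (b (ldual C (ldual C x)))) \<cdot>\<^bsub>C\<^esub> f)
      = left_trace C a d
        ((idm\<^bsub>C\<^esub> d \<otimes>\<^bsub>C\<^esub> lev C x) \<cdot>\<^bsub>C\<^esub> ((f \<cdot>\<^bsub>C\<^esub> h) \<otimes>\<^bsub>C\<^esub> idm\<^bsub>C\<^esub> (ldual C x))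
          \<cdot>\<^bsub>C\<^esub> (idm\<^bsub>C\<^esub> d \<otimes>\<^bsub>C\<^esub> lcoev C (ldual C x))))"

definition canonical_ddual_iso ::
    "('o, 'm, 'x) tensor_cat_scheme \<Rightarrow> ('o \<Rightarrow> 'm) \<Rightarrow> bool"
  where "canonical_ddual_iso C g \<longleftrightarrow> monoidal_nat_iso C (lddual C) (rddual C) g \<and>
    (\<forall>c x. \<forall>f \<in> Hom C x (ldual C (ldual C c)). \<forall>h \<in> Hom C c x.
      ev C (rdual C c) \<cdot>\<^bsub>C\<^esub> ((g c \<cdot>\<^bsub>C\<^esub> f \<cdot>\<^bsub>C\<^esub> h) \<otimes>\<^bsub>C\<^esub> idm\<^bsub>C\<^esub> (rdual C c)) \<cdot>\<^bsub>C\<^esub> coev C c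
      = lev C (ldual C c) \<cdot>\<^bsub>C\<^esub> (idm\<^bsub>C\<^esub> (ldual C c) \<otimes>\<^bsub>C\<^esub> (f \<cdot>\<^bsub>C\<^esub> h)) \<cdot>\<^bsub>C\<^esub> lcoev C c)"

end

theory Submission
  imports Defs "HOL-Computational_Algebra.Fundamental_Theorem_Algebra"
begin

text \<open>
  For $\psi : c \to c^{**}$ put
  $T_c(\psi) = \mathrm{ev}_{c^{*}} \circ (\psi \otimes \mathrm{id}) \circ \mathrm{coev}_c$. The right trace
  is $\mathrm{tr}^R_c(f) = T_c(a_c f)$. Monoidal naturality of \<open>a\<close> along $\mathrm{ev}_d$ gives
  $\mathrm{ev}_{d^{**}} \circ (a_{d^{*}} \otimes a_d) = \mathrm{ev}_d$; for $d = {}^{**}c$ this and the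
  definition of \<open>g\<close> yield $\mathrm{tr}^L_c(f) = T_c(g_c a_{{}^{**}c}^{-1} f)$. The pairing
  $(\psi, f) \mapsto T_c(\psi f)$ is nondegenerate in $\psi$, since by semisimplicity every nonzero
  morphism $c \otimes c^{*} \to 1$ splits. Hence \<open>a\<close> is spherical iff $a_c = g_c a_{{}^{**}c}^{-1}$
  for all \<open>c\<close>, and the defining equation of the conjugate becomes
  $\overline{a}_c = g_c a_{{}^{**}c}^{-1}$. The two composites in (i) agree by naturality.
\<close>

section \<open>Schur's lemma and splitting\<close>

text \<open>The work behind the step along ev_d is that the dual of a tensor product is only
  isomorphic to the product of the duals, and 1^* only to 1. One has to know that the monoidal
  functor of double right duals sends ev_d to the evaluation of d^{**}, modulo all its structure
  isomorphisms. This comes from transposing twice, since the transpose of an evaluation is a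
  coevaluation and conversely. Equalities of morphisms into a dual are checked after evaluation,
  where they turn into snake identities.

  Traces are complex numbers through End(1) = \<complex>, which rests on the existence of
  eigenvalues. The equation of the conjugate moreover contains a left trace at 1; that this trace
  returns the scalar itself requires computing a at the left dual of 1, an object merely isomorphic
  to 1.\<close>

context linear_category
begin

lemma zero_in_Hom: "0 \<in> Hom C c d"
  using Hom_subspace by (rule subspace_0)

lemma comp_zero_right:
  assumes "h \<in> Hom C d e" shows "h \<cdot> 0 = 0"
  using comp_add_right[OF assms zero_in_Hom zero_in_Hom] by simp

lemma comp_zero_left:
  assumes "f \<in> Hom C c d" shows "0 \<cdot> f = 0"
  using comp_add_left[OF zero_in_Hom zero_in_Hom assms] by simp

lemma comp_diff_right:
  assumes h: "h \<in> Hom C d e" and f: "f \<in> Hom C c d" "f' \<in> Hom C c d"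
  shows "h \<cdot> (f - f') = h \<cdot> f - h \<cdot> f'"
  using comp_add_right[OF h subspace_diff[OF Hom_subspace f] f(2)] by simp

lemma comp_diff_left:
  assumes h: "h \<in> Hom C d e" "h' \<in> Hom C d e" and f: "f \<in> Hom C c d"
  shows "(h - h') \<cdot> f = h \<cdot> f - h' \<cdot> f"
  using comp_add_left[OF subspace_diff[OF Hom_subspace h] h(2) f] by simp

lemma comp_sum_right:
  assumes "h \<in> Hom C d e" and "finite K" and "\<And>k. k \<in> K \<Longrightarrow> f k \<in> Hom C c d"
  shows "h \<cdot> (\<Sum>k\<in>K. f k) = (\<Sum>k\<in>K. h \<cdot> f k)"
  using assms(2,3)
proof (induction K)
  case empty
  then show ?case using comp_zero_right[OF assms(1)] by simp
next
  case (insert k K)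
  have "(\<Sum>k\<in>K. f k) \<in> Hom C c d"
    using insert.prems by (intro subspace_sum[OF Hom_subspace]) simp
  then show ?case
    using insert comp_add_right[OF assms(1), of "f k" c "\<Sum>k\<in>K. f k"] by simp
qed

lemma is_inverse_unique:
  assumes "is_inverse C c d f h" and "is_inverse C c d f h'"
  shows "h = h'"
proof -
  have "(h' \<cdot> f) \<cdot> h = h' \<cdot> (f \<cdot> h)"
    using assms comp_assoc unfolding is_inverse_def by metis
  then show ?thesis
    using assms ide_comp comp_ide unfolding is_inverse_def by metis
qed

lemma inverse_mor_eq:
  assumes "is_inverse C c d f h" shows "inverse_mor C c d f = h"
  unfolding inverse_mor_def using assms is_inverse_unique by blast

lemma is_inverse_inverse_mor:
  assumes "is_iso C c d f" shows "is_inverse C c d f (inverse_mor C c d f)"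
  using assms inverse_mor_eq unfolding is_iso_def by auto

lemma iso_cancel_left:
  assumes "is_iso C c d f" and u: "u \<in> Hom C b c" and v: "v \<in> Hom C b c" and eq: "f \<cdot> u = f \<cdot> v"
  shows "u = v"
proof -
  obtain h where h: "is_inverse C c d f h" using assms(1) unfolding is_iso_def by blast
  have "h \<cdot> (f \<cdot> u) = h \<cdot> (f \<cdot> v)" using eq by simp
  then show ?thesis
    using h comp_assoc[of h d c f c u b] comp_assoc[of h d c f c v b] u v ide_comp
    unfolding is_inverse_def by metis
qed

lemma iso_cancel_right:
  assumes "is_iso C c d f" and u: "u \<in> Hom C d e" and v: "v \<in> Hom C d e" and eq: "u \<cdot> f = v \<cdot> f"
  shows "u = v"
proof -
  obtain h where h: "is_inverse C c d f h" using assms(1) unfolding is_iso_def by blast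
  have "(u \<cdot> f) \<cdot> h = (v \<cdot> f) \<cdot> h" using eq by simp
  then show ?thesis
    using h comp_assoc[of u d e f c h d] comp_assoc[of v d e f c h d] u v comp_ide
    unfolding is_inverse_def by metis
qed

lemma from_zero_obj_eq_0:
  assumes "is_zero_obj C z" and "f \<in> Hom C z c" shows "f = 0"
  using assms zero_in_Hom unfolding is_zero_obj_def by blast

lemma to_zero_obj_eq_0:
  assumes "is_zero_obj C z" and "f \<in> Hom C c z" shows "f = 0"
  using assms zero_in_Hom unfolding is_zero_obj_def by blast

lemma is_zero_obj_iff: "is_zero_obj C z \<longleftrightarrow> idm z = 0"
proof
  assume "is_zero_obj C z"
  then show "idm z = 0" using from_zero_obj_eq_0 ide_in_Hom by blast
next
  assume 0: "idm z = 0"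
  have "f = 0" if "f \<in> Hom C z c" for f c
    using comp_ide[OF that] comp_zero_right[OF that] 0 by simp
  moreover have "f = 0" if "f \<in> Hom C c z" for f c
    using ide_comp[OF that] comp_zero_left[OF that] 0 by simp
  ultimately show "is_zero_obj C z"
    using zero_in_Hom unfolding is_zero_obj_def by blast
qed

end

context abelian_linear_category
begin

lemma mono_if_kernel_zero:
  assumes f: "f \<in> Hom C c d" and k: "is_kernel C c d f k i" and z: "is_zero_obj C k"
  shows "is_mono C c d f"
  unfolding is_mono_def
proof (intro conjI allI ballI impI)
  fix x u v assume u: "u \<in> Hom C x c" and v: "v \<in> Hom C x c" and eq: "f \<cdot> u = f \<cdot> v"
  have "u - v \<in> Hom C x c" "f \<cdot> (u - v) = 0"
    using subspace_diff[OF Hom_subspace u v] comp_diff_right[OF f u v] eq by auto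
  then obtain w where "w \<in> Hom C x k" "i \<cdot> w = u - v"
    using k unfolding is_kernel_def by metis
  moreover have "i \<in> Hom C k c" using k unfolding is_kernel_def by simp
  ultimately have "u - v = 0"
    using to_zero_obj_eq_0[OF z] comp_zero_right by metis
  then show "u = v" by simp
qed (rule f)

text \<open>Simplicity is phrased through subobjects. The kernel of f is a subobject of s, hence
  zero or all of s; the latter would force f = 0. So f is mono, that is, a subobject of t with
  nonzero source.\<close>

lemma schur_iso:
  assumes s: "is_simple C s" and t: "is_simple C t" and f: "f \<in> Hom C s t" and "f \<noteq> 0"
  shows "is_iso C s t f"
proof -
  obtain k i where k: "is_kernel C s t f k i" using ex_kernel[OF f] by blast
  then have i: "i \<in> Hom C k s" and fi: "f \<cdot> i = 0" unfolding is_kernel_def by auto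
  have "is_mono C k s i"
    unfolding is_mono_def
  proof (intro conjI allI ballI impI)
    fix x u v assume u: "u \<in> Hom C x k" and v: "v \<in> Hom C x k" and eq: "i \<cdot> u = i \<cdot> v"
    have "i \<cdot> u \<in> Hom C x s" using comp_in_Hom[OF i u] .
    moreover have "f \<cdot> (i \<cdot> u) = 0"
      using comp_assoc[OF f i u] fi comp_zero_left[OF u] by simp
    ultimately show "u = v"
      using k u v eq unfolding is_kernel_def by metis
  qed (rule i)
  then have "is_zero_obj C k \<or> is_iso C k s i" using s unfolding is_simple_def by blast
  moreover have "\<not> is_iso C k s i"
  proof
    assume "is_iso C k s i"
    from iso_cancel_right[OF this f zero_in_Hom] fi comp_zero_left[OF i] \<open>f \<noteq> 0\<close>
    show False by simp
  qed
  ultimately have "is_mono C s t f" using mono_if_kernel_zero[OF f k] by blast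
  then show ?thesis using s t unfolding is_simple_def by blast
qed

end

section \<open>Polynomials in an endomorphism\<close>

context linear_category
begin

text \<open>This is p(u) in End(s), evaluated by Horner's scheme. The type \<open>'m\<close> is only
  an additive group, and composition obeys the ring laws only inside a Hom space, so
  \<open>poly\<close> does not apply.\<close>

definition poly_mor :: "'o \<Rightarrow> 'm \<Rightarrow> complex poly \<Rightarrow> 'm"
  where "poly_mor s u p = fold_coeffs (\<lambda>z v. scale C z (idm s) + u \<cdot> v) p 0"

context
  fixes s u assumes u: "u \<in> Hom C s s"
begin

lemma poly_mor_0: "poly_mor s u 0 = 0"
  by (simp add: poly_mor_def)

lemma poly_mor_pCons: "poly_mor s u (pCons z p) = scale C z (idm s) + u \<cdot> poly_mor s u p"
\<comment> \<open>\<open>pCons 0 0\<close> is the zero polynomial with no coefficients, so here the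
  fold makes no step; the equation survives because u composed with 0 is 0.\<close>
proof (cases "z = 0 \<and> p = 0")
  case True
  then show ?thesis using comp_zero_right[OF u] by (simp add: poly_mor_def)
next
  case False
  then show ?thesis by (auto simp: poly_mor_def fold_coeffs_def cCons_def)
qed

lemma poly_mor_in_Hom: "poly_mor s u p \<in> Hom C s s"
proof (induction p)
  case 0
  then show ?case by (simp add: poly_mor_0 zero_in_Hom)
next
  case (pCons z p)
  then show ?case
    using subspace_add[OF Hom_subspace subspace_scale[OF Hom_subspace ide_in_Hom] comp_in_Hom[OF u]]
    by (simp add: poly_mor_pCons)
qed

lemma poly_mor_add: "poly_mor s u (p + q) = poly_mor s u p + poly_mor s u q"
proof (induction p q rule: poly_induct2)
  case 0
  then show ?case by (simp add: poly_mor_0)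
next
  case (pCons a p b q)
  then show ?case
    using comp_add_right[OF u poly_mor_in_Hom poly_mor_in_Hom]
    by (simp add: poly_mor_pCons scale_left_distrib)
qed

lemma poly_mor_smult: "poly_mor s u (smult z p) = scale C z (poly_mor s u p)"
proof (induction p)
  case 0
  then show ?case by (simp add: poly_mor_0)
next
  case (pCons a p)
  then show ?case
    using comp_scale_right[OF u poly_mor_in_Hom]
    by (simp add: poly_mor_pCons scale_right_distrib)
qed

lemma poly_mor_sum: "poly_mor s u (\<Sum>n\<in>N. p n) = (\<Sum>n\<in>N. poly_mor s u (p n))"
  by (induction N rule: infinite_finite_induct) (simp_all add: poly_mor_0 poly_mor_add)

text \<open>The case of multiplicativity with which a root of p is split off.\<close>

lemma poly_mor_linear_factor:
  "poly_mor s u ([:- z, 1:] * p) = (u - scale C z (idm s)) \<cdot> poly_mor s u p"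
proof -
  have "poly_mor s u ([:- z, 1:] * p) = scale C (- z) (poly_mor s u p) + u \<cdot> poly_mor s u p"
    unfolding mult_pCons_left poly_mor_add poly_mor_smult
    by (simp add: poly_mor_pCons)
  also have "\<dots> = (u - scale C z (idm s)) \<cdot> poly_mor s u p"
    using comp_diff_left[OF u subspace_scale[OF Hom_subspace ide_in_Hom] poly_mor_in_Hom]
      comp_scale_left[OF ide_in_Hom poly_mor_in_Hom] ide_comp[OF poly_mor_in_Hom]
    by simp
  finally show ?thesis .
qed

text \<open>The powers of u lie in a finite-dimensional space. Linear dependence is a property of
  sets, which does not see repetitions; hence two equal powers are treated separately, and distinct
  powers form an infinite, therefore dependent, set.\<close>

lemma ex_annihilating_poly:
  assumes B: "finite B" "Hom C s s \<subseteq> span B"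
  shows "\<exists>p. p \<noteq> 0 \<and> poly_mor s u p = 0"
proof (cases "inj (\<lambda>n. poly_mor s u (monom 1 n))")
  case False
  then obtain m n where mn: "m \<noteq> n" "poly_mor s u (monom 1 m) = poly_mor s u (monom 1 n)"
    unfolding inj_def by blast
  have "poly_mor s u (monom 1 m + smult (- 1) (monom 1 n)) = 0"
    unfolding poly_mor_add poly_mor_smult mn(2) by simp
  moreover have "monom 1 m + smult (- 1) (monom 1 n) \<noteq> (0 :: complex poly)"
    using mn(1) by (simp add: poly_eq_iff) (metis)
  ultimately show ?thesis by blast
next
  case inj: True
  let ?P = "\<lambda>n. poly_mor s u (monom 1 n)"
  have "range ?P \<subseteq> span B" using B(2) poly_mor_in_Hom by blast
  moreover have "infinite (range ?P)" using inj finite_imageD by blast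
  ultimately have "dependent (range ?P)"
    using independent_span_bound[OF B(1)] by blast
  then obtain U f where U: "finite U" "U \<subseteq> range ?P" "\<exists>v\<in>U. f v \<noteq> 0"
    and sum: "(\<Sum>v\<in>U. scale C (f v) v) = 0"
    unfolding dependent_explicit by blast
  obtain N where N: "U = ?P ` N" using U(2) by (auto simp: subset_image_iff)
  have injN: "inj_on ?P N" using inj by (rule inj_on_subset) simp
  have finN: "finite N" using U(1) injN unfolding N by (rule finite_imageD)
  let ?p = "\<Sum>n\<in>N. smult (f (?P n)) (monom 1 n)"
  have "poly_mor s u ?p = (\<Sum>n\<in>N. scale C (f (?P n)) (?P n))"
    by (simp only: poly_mor_sum poly_mor_smult)
  also have "\<dots> = 0" using sum unfolding N by (simp add: sum.reindex[OF injN])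
  finally have "poly_mor s u ?p = 0" .
  moreover obtain n where "n \<in> N" "f (?P n) \<noteq> 0" using U(3) unfolding N by blast
  \<comment> \<open>The coefficient of ?p at n is the coefficient of the n-th power of u in the
    dependence relation.\<close>
  then have "coeff ?p n \<noteq> 0"
    by (simp add: coeff_sum finN if_distrib[of "(*) _"] cong: if_cong)
  then have "?p \<noteq> 0" by (metis coeff_0)
  ultimately show ?thesis by blast
qed

end

end

section \<open>Endomorphisms of simple objects and split morphisms to the unit\<close>

context fusion_category
begin

text \<open>Over \<complex> an annihilating polynomial p of least degree has a root z, so p = (X -
  z) q with q(u) nonzero by minimality. Then u - z kills q(u), is not invertible, and vanishes by
  Schur's lemma.\<close>

lemma simple_endomorphism_scalar:
  assumes s: "is_simple C s" and u: "u \<in> Hom C s s"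
  shows "\<exists>z. u = scale C z (idm s)"
proof -
  obtain B where "finite B" "Hom C s s \<subseteq> span B" using Hom_finite_dim by blast
  then have "\<exists>p. p \<noteq> 0 \<and> poly_mor s u p = 0" by (rule ex_annihilating_poly[OF u])
  then obtain p0 where "p0 \<noteq> 0 \<and> poly_mor s u p0 = 0" by blast
  from ex_has_least_nat[of "\<lambda>p. p \<noteq> 0 \<and> poly_mor s u p = 0", OF this, of degree]
  obtain p where p: "p \<noteq> 0" "poly_mor s u p = 0"
    and min: "\<And>q. q \<noteq> 0 \<and> poly_mor s u q = 0 \<Longrightarrow> degree p \<le> degree q"
    by blast
  have ids: "idm s \<noteq> 0" using s is_zero_obj_iff unfolding is_simple_def by blast
  have "degree p \<noteq> 0"
  proof
    assume "degree p = 0"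
    then obtain z where z: "p = [:z:]" using degree_eq_zeroE by blast
    then have "scale C z (idm s) = 0"
      using p(2) comp_zero_right[OF u] by (simp add: poly_mor_pCons[OF u] poly_mor_0[OF u])
    then show False using ids p(1) z by simp
  qed
  then have "\<not> constant (poly p)" by (simp add: constant_degree)
  then obtain z where "poly p z = 0" using fundamental_theorem_of_algebra by blast
  then obtain q where q: "p = [:- z, 1:] * q" using poly_eq_0_iff_dvd dvd_def by blast
  have q0: "q \<noteq> 0" using p(1) q by auto
  have "degree p = Suc (degree q)" unfolding q using q0 by (subst degree_mult_eq) auto
  then have qu: "poly_mor s u q \<noteq> 0" using min q0 by fastforce
  let ?w = "u - scale C z (idm s)"
  have w: "?w \<in> Hom C s s"
    using subspace_diff[OF Hom_subspace u subspace_scale[OF Hom_subspace ide_in_Hom]] .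
  have "?w \<cdot> poly_mor s u q = ?w \<cdot> 0"
    using p(2) poly_mor_linear_factor[OF u] comp_zero_right[OF w] unfolding q by simp
  then have "\<not> is_iso C s s ?w"
    using iso_cancel_left[OF _ poly_mor_in_Hom[OF u] zero_in_Hom] qu by blast
  then have "?w = 0" using schur_iso[OF s s w] by blast
  then show ?thesis by auto
qed

lemma scale_scalar_of:
  assumes "u \<in> Hom C \<one> \<one>" shows "scale C (scalar_of C u) (idm \<one>) = u"
proof -
  obtain z where z: "u = scale C z (idm \<one>)"
    using simple_endomorphism_scalar[OF simple_unit assms] by blast
  have "idm \<one> \<noteq> 0" using simple_unit is_zero_obj_iff unfolding is_simple_def by blast
  then have "w = z" if "u = scale C w (idm \<one>)" for w
    using z that scale_right_imp_eq by metis
  then have "scalar_of C u = z" unfolding scalar_of_def using z by blast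
  then show ?thesis using z by simp
qed

text \<open>Allows an equation between traces to be replaced by one between endomorphisms of
  1.\<close>

lemma scalar_of_eq_iff:
  assumes "u \<in> Hom C \<one> \<one>" and "v \<in> Hom C \<one> \<one>"
  shows "scalar_of C u = scalar_of C v \<longleftrightarrow> u = v"
  using assms scale_scalar_of by metis

text \<open>Decompose y into simple summands. Since u is nonzero, so is its restriction to some
  summand, and this restriction is an isomorphism onto 1 by Schur's lemma; its inverse followed by
  the inclusion is the section.\<close>

lemma nonzero_to_unit_splits:
  assumes u: "u \<in> Hom C y \<one>" and "u \<noteq> 0"
  shows "\<exists>v \<in> Hom C \<one> y. u \<cdot> v = idm \<one>"
proof -
  obtain xs where simple: "\<forall>s \<in> set xs. is_simple C s" and "is_direct_sum C xs y"
    using semisimple by blast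
  then obtain i p where ip: "\<And>k. k < length xs \<Longrightarrow> i k \<in> Hom C (xs ! k) y \<and> p k \<in> Hom C y (xs ! k)"
    and sum: "(\<Sum>k < length xs. i k \<cdot> p k) = idm y"
    unfolding is_direct_sum_def by metis
  have "u = (\<Sum>k < length xs. u \<cdot> (i k \<cdot> p k))"
  proof -
    have "u \<cdot> (\<Sum>k < length xs. i k \<cdot> p k) = (\<Sum>k < length xs. u \<cdot> (i k \<cdot> p k))"
      by (rule comp_sum_right[OF u finite_lessThan]) (use ip comp_in_Hom in blast)
    then show ?thesis unfolding sum comp_ide[OF u] .
  qed
  with \<open>u \<noteq> 0\<close> have "(\<Sum>k < length xs. u \<cdot> (i k \<cdot> p k)) \<noteq> 0" by simp
  then obtain k where "k \<in> {..<length xs}" and k2: "u \<cdot> (i k \<cdot> p k) \<noteq> 0"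
    by (rule sum.not_neutral_contains_not_neutral)
  then have k: "k < length xs" "u \<cdot> (i k \<cdot> p k) \<noteq> 0" by auto
  have i: "i k \<in> Hom C (xs ! k) y" and p: "p k \<in> Hom C y (xs ! k)" using ip k(1) by auto
  have "u \<cdot> i k \<noteq> 0" using k(2) comp_assoc[OF u i p] comp_zero_left[OF p] by auto
  moreover have "is_simple C (xs ! k)" using simple k(1) by simp
  ultimately have "is_iso C (xs ! k) \<one> (u \<cdot> i k)"
    using schur_iso simple_unit comp_in_Hom[OF u i] by blast
  then obtain w where w: "w \<in> Hom C \<one> (xs ! k)" "(u \<cdot> i k) \<cdot> w = idm \<one>"
    unfolding is_iso_def is_inverse_def by blast
  then show ?thesis
    using comp_assoc[OF u i w(1)] comp_in_Hom[OF i w(1)] by auto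
qed

end

section \<open>Dual pairs\<close>

context strict_tensor_category
begin

lemmas tobj_simps = tobj_assoc tobj_unit_left tobj_unit_right

lemma ide_tmor_comp:
  assumes "h \<in> Hom C d e" and "f \<in> Hom C c d"
  shows "idm x \<otimes> (h \<cdot> f) = (idm x \<otimes> h) \<cdot> (idm x \<otimes> f)"
  using tmor_comp[OF ide_in_Hom ide_in_Hom assms] ide_comp[OF ide_in_Hom] by simp

lemma comp_tmor_ide:
  assumes "h \<in> Hom C d e" and "f \<in> Hom C c d"
  shows "(h \<cdot> f) \<otimes> idm x = (h \<otimes> idm x) \<cdot> (f \<otimes> idm x)"
  using tmor_comp[OF assms ide_in_Hom ide_in_Hom] ide_comp[OF ide_in_Hom] by simp

text \<open>With \<open>tmor_split_right\<close> this is the interchange law: morphisms on different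
  tensor factors may be performed in either order. Every fact called \<open>slide\<close> below is
  an instance.\<close>

lemma tmor_split_left:
  assumes "f \<in> Hom C c d" and "f' \<in> Hom C c' d'"
  shows "(f \<otimes> idm d') \<cdot> (idm c \<otimes> f') = f \<otimes> f'"
  using tmor_comp[OF assms(1) ide_in_Hom ide_in_Hom assms(2)] comp_ide[OF assms(1)] ide_comp[OF assms(2)]
  by simp

lemma tmor_split_right:
  assumes "f \<in> Hom C c d" and "f' \<in> Hom C c' d'"
  shows "(idm d \<otimes> f') \<cdot> (f \<otimes> idm c') = f \<otimes> f'"
  using tmor_comp[OF ide_in_Hom assms(1) assms(2) ide_in_Hom] ide_comp[OF assms(1)] comp_ide[OF assms(2)]
  by simp

lemma tmor_ide_ide: "f \<in> Hom C c d \<Longrightarrow> (f \<otimes> idm x) \<otimes> idm y = f \<otimes> idm (x \<odot> y)"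
  using tmor_assoc[OF _ ide_in_Hom ide_in_Hom] by (simp add: tmor_ide)

lemma ide_ide_tmor: "f \<in> Hom C c d \<Longrightarrow> idm x \<otimes> (idm y \<otimes> f) = idm (x \<odot> y) \<otimes> f"
  using tmor_assoc[OF ide_in_Hom ide_in_Hom] by (simp add: tmor_ide)

lemma tmor_ide_in_Hom: "f \<in> Hom C c d \<Longrightarrow> f \<otimes> idm x \<in> Hom C (c \<odot> x) (d \<odot> x)"
  by (rule tmor_in_Hom[OF _ ide_in_Hom])

lemma ide_tmor_in_Hom: "f \<in> Hom C c d \<Longrightarrow> idm x \<otimes> f \<in> Hom C (x \<odot> c) (x \<odot> d)"
  by (rule tmor_in_Hom[OF ide_in_Hom])

text \<open>States that y is a right dual of x with evaluation e and coevaluation k. Keeping all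
  four variable covers the chosen right duals, the chosen left duals and the duals of tensor
  products at once.\<close>

definition dual_pair :: "'a \<Rightarrow> 'a \<Rightarrow> 'b \<Rightarrow> 'b \<Rightarrow> bool"
  where "dual_pair x y e k \<longleftrightarrow> e \<in> Hom C (y \<odot> x) \<one> \<and> k \<in> Hom C \<one> (x \<odot> y) \<and>
    (idm x \<otimes> e) \<cdot> (k \<otimes> idm x) = idm x \<and> (e \<otimes> idm y) \<cdot> (idm y \<otimes> k) = idm y"

text \<open>Half of the bijection between Hom(w, y) and Hom(w \<otimes> x, 1) given by evaluation: u
  slides past k, and a snake remains. The other half is \<open>dual_pair_bend\<close>.\<close>

lemma dual_pair_unbend:
  assumes "dual_pair x y e k" and u: "u \<in> Hom C w y"
  shows "((e \<cdot> (u \<otimes> idm x)) \<otimes> idm y) \<cdot> (idm w \<otimes> k) = u"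
proof -
  have e: "e \<in> Hom C (y \<odot> x) \<one>" and k: "k \<in> Hom C \<one> (x \<odot> y)"
    and snake: "(e \<otimes> idm y) \<cdot> (idm y \<otimes> k) = idm y"
    using assms(1) unfolding dual_pair_def by auto
  note T = tmor_ide_in_Hom[OF e, of y, unfolded tobj_simps] tmor_ide_in_Hom[OF u, of "x \<odot> y"]
    ide_tmor_in_Hom[OF k, of w, unfolded tobj_simps] ide_tmor_in_Hom[OF k, of y, unfolded tobj_simps]
  have slide: "(u \<otimes> idm (x \<odot> y)) \<cdot> (idm w \<otimes> k) = (idm y \<otimes> k) \<cdot> u"
    using tmor_split_left[OF u k] tmor_split_right[OF u k] tmor_unit_right[OF u] by simp
  have "((e \<cdot> (u \<otimes> idm x)) \<otimes> idm y) \<cdot> (idm w \<otimes> k)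
      = ((e \<otimes> idm y) \<cdot> (u \<otimes> idm (x \<odot> y))) \<cdot> (idm w \<otimes> k)"
    using comp_tmor_ide[OF e tmor_ide_in_Hom[OF u]] tmor_ide_ide[OF u] by simp
  also have "\<dots> = (e \<otimes> idm y) \<cdot> ((idm y \<otimes> k) \<cdot> u)"
    using comp_assoc[OF T(1-3)] slide by simp
  also have "\<dots> = u"
    using comp_assoc[OF T(1,4) u] snake ide_comp[OF u] by simp
  finally show ?thesis .
qed

lemma dual_pair_bend:
  assumes "dual_pair x y e k" and e': "e' \<in> Hom C (w \<odot> x) \<one>"
  shows "(e' \<otimes> idm y) \<cdot> (idm w \<otimes> k) \<in> Hom C w y"
    and "e \<cdot> (((e' \<otimes> idm y) \<cdot> (idm w \<otimes> k)) \<otimes> idm x) = e'"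
proof -
  have e: "e \<in> Hom C (y \<odot> x) \<one>" and k: "k \<in> Hom C \<one> (x \<odot> y)"
    and snake: "(idm x \<otimes> e) \<cdot> (k \<otimes> idm x) = idm x"
    using assms(1) unfolding dual_pair_def by auto
  note T = tmor_ide_in_Hom[OF e', of y, unfolded tobj_simps] ide_tmor_in_Hom[OF k, of w, unfolded tobj_simps]
  show "(e' \<otimes> idm y) \<cdot> (idm w \<otimes> k) \<in> Hom C w y" using comp_in_Hom[OF T] .
  note S = tmor_ide_in_Hom[OF e', of "y \<odot> x", unfolded tobj_simps]
    tmor_ide_in_Hom[OF T(2), of x, unfolded tobj_simps]
  note R = ide_tmor_in_Hom[OF e, of "w \<odot> x", unfolded tobj_simps]
  have 1: "((e' \<otimes> idm y) \<cdot> (idm w \<otimes> k)) \<otimes> idm x = (e' \<otimes> idm (y \<odot> x)) \<cdot> ((idm w \<otimes> k) \<otimes> idm x)"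
    using comp_tmor_ide[OF T] tmor_ide_ide[OF e'] by simp
  have slide: "e \<cdot> (e' \<otimes> idm (y \<odot> x)) = e' \<cdot> (idm (w \<odot> x) \<otimes> e)"
    using tmor_split_right[OF e' e] tmor_split_left[OF e' e] tmor_unit_left[OF e] tmor_unit_right[OF e']
    by simp
  have "(idm (w \<odot> x) \<otimes> e) \<cdot> ((idm w \<otimes> k) \<otimes> idm x)
      = (idm w \<otimes> (idm x \<otimes> e)) \<cdot> (idm w \<otimes> (k \<otimes> idm x))"
    using ide_ide_tmor[OF e] tmor_assoc[OF ide_in_Hom k ide_in_Hom] by simp
  also have "\<dots> = idm (w \<odot> x)"
    using ide_tmor_comp[OF ide_tmor_in_Hom[OF e, of x] tmor_ide_in_Hom[OF k, of x, unfolded tobj_simps], of w]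
      snake by (simp add: tmor_ide tobj_simps)
  finally have 2: "(idm (w \<odot> x) \<otimes> e) \<cdot> ((idm w \<otimes> k) \<otimes> idm x) = idm (w \<odot> x)" .
  have "e \<cdot> (((e' \<otimes> idm y) \<cdot> (idm w \<otimes> k)) \<otimes> idm x) = e' \<cdot> ((idm (w \<odot> x) \<otimes> e) \<cdot> ((idm w \<otimes> k) \<otimes> idm x))"
    unfolding 1 using comp_assoc[OF e S] comp_assoc[OF e' R S(2)] slide by simp
  then show "e \<cdot> (((e' \<otimes> idm y) \<cdot> (idm w \<otimes> k)) \<otimes> idm x) = e'"
    using 2 comp_ide[OF e'] by simp
qed

text \<open>The companion bijection between Hom(x, w) and Hom(1, w \<otimes> y), here its
  surjectivity; for w = x it turns a section of a morphism to 1 into an endomorphism of x.\<close>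

lemma dual_pair_bend_coev:
  assumes "dual_pair x y e k" and v: "v \<in> Hom C \<one> (w \<odot> y)"
  shows "\<exists>f \<in> Hom C x w. (f \<otimes> idm y) \<cdot> k = v"
proof
  let ?f = "(idm w \<otimes> e) \<cdot> (v \<otimes> idm x)"
  have e: "e \<in> Hom C (y \<odot> x) \<one>" and k: "k \<in> Hom C \<one> (x \<odot> y)"
    and snake: "(e \<otimes> idm y) \<cdot> (idm y \<otimes> k) = idm y"
    using assms(1) unfolding dual_pair_def by auto
  note T = ide_tmor_in_Hom[OF e, of w, unfolded tobj_simps] tmor_ide_in_Hom[OF v, of x, unfolded tobj_simps]
  show "?f \<in> Hom C x w" using comp_in_Hom[OF T] .
  note S = tmor_ide_in_Hom[OF T(1), of y, unfolded tobj_simps]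
    tmor_ide_in_Hom[OF v, of "x \<odot> y", unfolded tobj_simps]
  note R = ide_tmor_in_Hom[OF k, of "w \<odot> y", unfolded tobj_simps]
  have 1: "?f \<otimes> idm y = ((idm w \<otimes> e) \<otimes> idm y) \<cdot> (v \<otimes> idm (x \<odot> y))"
    using comp_tmor_ide[OF T] tmor_ide_ide[OF v] by simp
  have slide: "(v \<otimes> idm (x \<odot> y)) \<cdot> k = (idm (w \<odot> y) \<otimes> k) \<cdot> v"
    using tmor_split_left[OF v k] tmor_split_right[OF v k] tmor_unit_left[OF k] tmor_unit_right[OF v]
    by simp
  have "((idm w \<otimes> e) \<otimes> idm y) \<cdot> (idm (w \<odot> y) \<otimes> k)
      = (idm w \<otimes> (e \<otimes> idm y)) \<cdot> (idm w \<otimes> (idm y \<otimes> k))"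
    using ide_ide_tmor[OF k] tmor_assoc[OF ide_in_Hom e ide_in_Hom] by simp
  also have "\<dots> = idm (w \<odot> y)"
    using ide_tmor_comp[OF tmor_ide_in_Hom[OF e, of y, unfolded tobj_simps] ide_tmor_in_Hom[OF k, of y, unfolded tobj_simps], of w]
      snake by (simp add: tmor_ide)
  finally have 2: "((idm w \<otimes> e) \<otimes> idm y) \<cdot> (idm (w \<odot> y) \<otimes> k) = idm (w \<odot> y)" .
  show "(?f \<otimes> idm y) \<cdot> k = v"
    unfolding 1 using comp_assoc[OF S k] slide comp_assoc[OF S(1) R v] 2 ide_comp[OF v] by simp
qed

text \<open>The standard way below to prove equations between morphisms into a dual: compare them
  after evaluation.\<close>

lemma dual_pair_cancel:
  assumes "dual_pair x y e k" and "u \<in> Hom C w y" and "v \<in> Hom C w y"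
    and "e \<cdot> (u \<otimes> idm x) = e \<cdot> (v \<otimes> idm x)"
  shows "u = v"
  using dual_pair_unbend[OF assms(1,2)] dual_pair_unbend[OF assms(1,3)] unfolding assms(4) by (rule trans[OF sym])

text \<open>Apply e to the two middle factors of k \<otimes> k'. Contracting the snake of k leaves
  k', contracting the snake of k' leaves k.\<close>

lemma dual_pair_unique_coev:
  assumes d: "dual_pair x y e k" and d': "dual_pair x y e k'"
  shows "k' = k"
proof -
  have k: "k \<in> Hom C \<one> (x \<odot> y)" and k': "k' \<in> Hom C \<one> (x \<odot> y)" and e: "e \<in> Hom C (y \<odot> x) \<one>"
    and snake: "(idm x \<otimes> e) \<cdot> (k \<otimes> idm x) = idm x"
    and snake': "(e \<otimes> idm y) \<cdot> (idm y \<otimes> k') = idm y"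
    using d d' unfolding dual_pair_def by auto
  note T = ide_tmor_in_Hom[OF e, of x, unfolded tobj_simps] tmor_ide_in_Hom[OF k, of x, unfolded tobj_simps]
  note S = tmor_ide_in_Hom[OF T(1), of y, unfolded tobj_simps]
    tmor_ide_in_Hom[OF k, of "x \<odot> y", unfolded tobj_simps]
  note R = ide_tmor_in_Hom[OF k', of "x \<odot> y", unfolded tobj_simps]
  have slide: "(k \<otimes> idm (x \<odot> y)) \<cdot> k' = (idm (x \<odot> y) \<otimes> k') \<cdot> k"
    using tmor_split_left[OF k k'] tmor_split_right[OF k k'] tmor_unit_left[OF k'] tmor_unit_right[OF k]
    by simp
  have "((idm x \<otimes> e) \<otimes> idm y) \<cdot> (idm (x \<odot> y) \<otimes> k')
      = (idm x \<otimes> (e \<otimes> idm y)) \<cdot> (idm x \<otimes> (idm y \<otimes> k'))"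
    using ide_ide_tmor[OF k'] tmor_assoc[OF ide_in_Hom e ide_in_Hom] by simp
  also have "\<dots> = idm (x \<odot> y)"
    using ide_tmor_comp[OF tmor_ide_in_Hom[OF e, of y, unfolded tobj_simps] ide_tmor_in_Hom[OF k', of y, unfolded tobj_simps], of x]
      snake' by (simp add: tmor_ide)
  finally have 2: "((idm x \<otimes> e) \<otimes> idm y) \<cdot> (idm (x \<odot> y) \<otimes> k') = idm (x \<odot> y)" .
  have "k' = (((idm x \<otimes> e) \<otimes> idm y) \<cdot> (k \<otimes> idm (x \<odot> y))) \<cdot> k'"
    using comp_tmor_ide[OF T, of y] tmor_ide_ide[OF k] snake ide_comp[OF k'] by (simp add: tmor_ide)
  also have "\<dots> = k"
    using comp_assoc[OF S k'] slide comp_assoc[OF S(1) R k] 2 ide_comp[OF k] by simp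
  finally show ?thesis .
qed

text \<open>Each comparison map carries one evaluation to the other, so their composite preserves an
  evaluation, as does the identity.\<close>

lemma dual_pair_comparison_inverse:
  assumes d: "dual_pair x y e k" and d': "dual_pair x y' e' k'"
  shows "is_inverse C y y' ((e \<otimes> idm y') \<cdot> (idm y \<otimes> k')) ((e' \<otimes> idm y) \<cdot> (idm y' \<otimes> k))"
proof -
  \<comment> \<open>Stated for arbitrary pairs so that exchanging the two duals gives the other
    composite.\<close>
  have inv: "((e' \<otimes> idm y) \<cdot> (idm y' \<otimes> k)) \<cdot> ((e \<otimes> idm y') \<cdot> (idm y \<otimes> k')) = idm y"
    if d: "dual_pair x y e k" and d': "dual_pair x y' e' k'" for y e k y' e' k'
  proof -
    let ?t = "(e \<otimes> idm y') \<cdot> (idm y \<otimes> k')" and ?s = "(e' \<otimes> idm y) \<cdot> (idm y' \<otimes> k)"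
    have e: "e \<in> Hom C (y \<odot> x) \<one>" and e': "e' \<in> Hom C (y' \<odot> x) \<one>"
      using d d' unfolding dual_pair_def by auto
    note t = dual_pair_bend[OF d' e] and s = dual_pair_bend[OF d e']
    have "e \<cdot> ((?s \<cdot> ?t) \<otimes> idm x) = e"
      using comp_tmor_ide[OF s(1) t(1), of x] s(2) t(2)
        comp_assoc[OF e tmor_ide_in_Hom[OF s(1)] tmor_ide_in_Hom[OF t(1)]] by simp
    also have "\<dots> = e \<cdot> (idm y \<otimes> idm x)" using comp_ide[OF e] by (simp add: tmor_ide)
    finally show ?thesis
      by (rule dual_pair_cancel[OF d comp_in_Hom[OF s(1) t(1)] ide_in_Hom])
  qed
  have e: "e \<in> Hom C (y \<odot> x) \<one>" and e': "e' \<in> Hom C (y' \<odot> x) \<one>"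
    using d d' unfolding dual_pair_def by auto
  show ?thesis
    unfolding is_inverse_def
    using dual_pair_bend(1)[OF d' e] dual_pair_bend(1)[OF d e'] inv[OF d d'] inv[OF d' d] by blast
qed

text \<open>The evaluations and coevaluations are nested. In each snake the inner e and k' act on
  disjoint factors; once they are exchanged, the diagram falls apart into the snakes of the two
  given pairs.\<close>

lemma dual_pair_tensor:
  assumes d: "dual_pair x y e k" and d': "dual_pair x' y' e' k'"
  shows "dual_pair (x \<odot> x') (y' \<odot> y) (e' \<cdot> (idm y' \<otimes> e \<otimes> idm x')) ((idm x \<otimes> k' \<otimes> idm y) \<cdot> k)"
proof -
  have e: "e \<in> Hom C (y \<odot> x) \<one>" and k: "k \<in> Hom C \<one> (x \<odot> y)"
    and snake1: "(idm x \<otimes> e) \<cdot> (k \<otimes> idm x) = idm x"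
    and snake2: "(e \<otimes> idm y) \<cdot> (idm y \<otimes> k) = idm y"
    using d unfolding dual_pair_def by auto
  have e': "e' \<in> Hom C (y' \<odot> x') \<one>" and k': "k' \<in> Hom C \<one> (x' \<odot> y')"
    and snake1': "(idm x' \<otimes> e') \<cdot> (k' \<otimes> idm x') = idm x'"
    and snake2': "(e' \<otimes> idm y') \<cdot> (idm y' \<otimes> k') = idm y'"
    using d' unfolding dual_pair_def by auto
  have e1: "e \<otimes> idm x' \<in> Hom C (y \<odot> x \<odot> x') x'"
    using tmor_ide_in_Hom[OF e, of x'] by (simp add: tobj_simps)
  have e2: "idm y' \<otimes> e \<otimes> idm x' \<in> Hom C (y' \<odot> y \<odot> x \<odot> x') (y' \<odot> x')"
    using ide_tmor_in_Hom[OF e1] .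
  have k1: "k' \<otimes> idm y \<in> Hom C y (x' \<odot> y' \<odot> y)"
    using tmor_ide_in_Hom[OF k', of y] by (simp add: tobj_simps)
  have k2: "idm x \<otimes> k' \<otimes> idm y \<in> Hom C (x \<odot> y) (x \<odot> x' \<odot> y' \<odot> y)"
    using ide_tmor_in_Hom[OF k1] .
  let ?E = "e' \<cdot> (idm y' \<otimes> e \<otimes> idm x')" and ?K = "(idm x \<otimes> k' \<otimes> idm y) \<cdot> k"
  have E: "?E \<in> Hom C (y' \<odot> y \<odot> x \<odot> x') \<one>" using comp_in_Hom[OF e' e2] .
  have K: "?K \<in> Hom C \<one> (x \<odot> x' \<odot> y' \<odot> y)" using comp_in_Hom[OF k2 k] .
  have ke: "(idm (x' \<odot> y') \<otimes> e) \<cdot> (k' \<otimes> idm (y \<odot> x)) = k' \<cdot> e"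
    "(e \<otimes> idm (x' \<odot> y')) \<cdot> (idm (y \<odot> x) \<otimes> k') = k' \<cdot> e"
    using tmor_split_left[OF k' e] tmor_split_right[OF k' e] tmor_split_left[OF e k'] tmor_split_right[OF e k']
     tmor_unit_left[OF k'] tmor_unit_right[OF k'] tmor_unit_left[OF e] tmor_unit_right[OF e]
    by simp_all
  have s1: "(idm (x \<odot> x') \<otimes> ?E) \<cdot> (?K \<otimes> idm (x \<odot> x')) = idm (x \<odot> x')"
  proof -
    define A where "A = idm x \<otimes> idm x' \<otimes> e'"
    define B where "B = idm x \<otimes> (idm (x' \<odot> y') \<otimes> e) \<otimes> idm x'"
    define D where "D = idm x \<otimes> (k' \<otimes> idm (y \<odot> x)) \<otimes> idm x'"
    define F where "F = k \<otimes> idm x \<otimes> idm x'"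
    define G where "G = idm x \<otimes> k' \<otimes> idm x'"
    define H where "H = idm x \<otimes> e \<otimes> idm x'"
    have A: "A \<in> Hom C (x \<odot> x' \<odot> y' \<odot> x') (x \<odot> x')"
      using ide_tmor_in_Hom[OF ide_tmor_in_Hom[OF e', of x'], of x] by (simp add: A_def tobj_simps)
    have B: "B \<in> Hom C (x \<odot> x' \<odot> y' \<odot> y \<odot> x \<odot> x') (x \<odot> x' \<odot> y' \<odot> x')"
      using ide_tmor_in_Hom[OF tmor_ide_in_Hom[OF ide_tmor_in_Hom[OF e, of "x' \<odot> y'"], of x'], of x]
      by (simp add: B_def tobj_simps)
    have D: "D \<in> Hom C (x \<odot> y \<odot> x \<odot> x') (x \<odot> x' \<odot> y' \<odot> y \<odot> x \<odot> x')"
      using ide_tmor_in_Hom[OF tmor_ide_in_Hom[OF tmor_ide_in_Hom[OF k', of "y \<odot> x"], of x'], of x]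
      by (simp add: D_def tobj_simps)
    have F: "F \<in> Hom C (x \<odot> x') (x \<odot> y \<odot> x \<odot> x')"
      using tmor_ide_in_Hom[OF k, of "x \<odot> x'"] by (simp add: F_def tobj_simps tmor_ide)
    have G: "G \<in> Hom C (x \<odot> x') (x \<odot> x' \<odot> y' \<odot> x')"
      using ide_tmor_in_Hom[OF tmor_ide_in_Hom[OF k', of x'], of x] by (simp add: G_def tobj_simps)
    have H: "H \<in> Hom C (x \<odot> y \<odot> x \<odot> x') (x \<odot> x')"
      using ide_tmor_in_Hom[OF e1, of x] by (simp add: H_def)
    have 1: "idm (x \<odot> x') \<otimes> ?E = A \<cdot> B"
    proof -
      have "idm (x \<odot> x') \<otimes> ?E = (idm (x \<odot> x') \<otimes> e') \<cdot> (idm (x \<odot> x') \<otimes> idm y' \<otimes> e \<otimes> idm x')"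
        by (rule ide_tmor_comp[OF e' e2])
      moreover have "idm (x \<odot> x') \<otimes> e' = A" unfolding A_def using ide_ide_tmor[OF e'] by simp
      moreover have "idm (x \<odot> x') \<otimes> idm y' \<otimes> e \<otimes> idm x' = B"
        unfolding B_def
        using ide_ide_tmor[OF e1] tmor_assoc[OF ide_in_Hom e ide_in_Hom] by (simp add: tobj_simps)
      ultimately show ?thesis by simp
    qed
    have 2: "?K \<otimes> idm (x \<odot> x') = D \<cdot> F"
    proof -
      have "?K \<otimes> idm (x \<odot> x') = ((idm x \<otimes> k' \<otimes> idm y) \<otimes> idm (x \<odot> x')) \<cdot> (k \<otimes> idm (x \<odot> x'))"
        by (rule comp_tmor_ide[OF k2 k])
      moreover have "k \<otimes> idm (x \<odot> x') = F" unfolding F_def by (simp add: tmor_ide)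
      moreover have "(idm x \<otimes> k' \<otimes> idm y) \<otimes> idm (x \<odot> x') = D"
        unfolding D_def
        using tmor_assoc[OF ide_in_Hom k1 ide_in_Hom] tmor_ide_ide[OF k'] by (simp add: tobj_simps)
      ultimately show ?thesis by simp
    qed
    \<comment> \<open>The exchange: \<open>B\<close> applies e, \<open>D\<close> creates k'. In the
      new order \<open>A\<close> meets \<open>G\<close> in the snake of x', and \<open>H\<close>
      meets \<open>F\<close> in the snake of x.\<close>
    have 3: "B \<cdot> D = G \<cdot> H"
    proof -
      note t1 = ide_tmor_in_Hom[OF e, of "x' \<odot> y'"] and t2 = tmor_ide_in_Hom[OF k', of "y \<odot> x"]
      note t1' = t1[unfolded tobj_simps] and t2' = t2[unfolded tobj_simps]
      have "B \<cdot> D = idm x \<otimes> ((idm (x' \<odot> y') \<otimes> e) \<cdot> (k' \<otimes> idm (y \<odot> x))) \<otimes> idm x'"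
        unfolding B_def D_def
        using ide_tmor_comp[OF tmor_ide_in_Hom[OF t1', of x'] tmor_ide_in_Hom[OF t2', of x'], of x]
          comp_tmor_ide[OF t1' t2', of x'] by simp
      also have "\<dots> = idm x \<otimes> ((k' \<otimes> idm x') \<cdot> (e \<otimes> idm x'))"
        unfolding ke using comp_tmor_ide[OF k' e] by simp
      also have "\<dots> = G \<cdot> H"
        unfolding G_def H_def
        using ide_tmor_comp[OF tmor_ide_in_Hom[OF k'] tmor_ide_in_Hom[OF e]] .
      finally show ?thesis .
    qed
    have 4: "A \<cdot> G = idm (x \<odot> x')"
      unfolding A_def G_def
      using ide_tmor_comp[OF ide_tmor_in_Hom[OF e', of x'] tmor_ide_in_Hom[OF k', of x', unfolded tobj_simps], of x]
        snake1' by (simp add: tmor_ide)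
    have 5: "H \<cdot> F = idm (x \<odot> x')"
      unfolding H_def F_def
      using comp_tmor_ide[OF ide_tmor_in_Hom[OF e, of x] tmor_ide_in_Hom[OF k, of x, unfolded tobj_simps], of x']
        snake1 tmor_assoc[OF ide_in_Hom e ide_in_Hom, of x x'] tmor_assoc[OF k ide_in_Hom ide_in_Hom, of x x']
      by (simp add: tmor_ide)
    have "(A \<cdot> B) \<cdot> (D \<cdot> F) = A \<cdot> ((B \<cdot> D) \<cdot> F)"
      using comp_assoc[OF A B comp_in_Hom[OF D F]] comp_assoc[OF B D F] by simp
    also have "\<dots> = (A \<cdot> G) \<cdot> (H \<cdot> F)"
      unfolding 3 using comp_assoc[OF G H F] comp_assoc[OF A G comp_in_Hom[OF H F]] by simp
    also have "\<dots> = idm (x \<odot> x')" unfolding 4 5 by (rule ide_comp[OF ide_in_Hom])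
    finally show ?thesis unfolding 1 2 .
  qed
  have s2: "(?E \<otimes> idm (y' \<odot> y)) \<cdot> (idm (y' \<odot> y) \<otimes> ?K) = idm (y' \<odot> y)"
  proof -
    define A where "A = e' \<otimes> idm y' \<otimes> idm y"
    define B where "B = idm y' \<otimes> (e \<otimes> idm (x' \<odot> y')) \<otimes> idm y"
    define D where "D = idm y' \<otimes> (idm (y \<odot> x) \<otimes> k') \<otimes> idm y"
    define F where "F = idm y' \<otimes> idm y \<otimes> k"
    define G where "G = idm y' \<otimes> k' \<otimes> idm y"
    define H where "H = idm y' \<otimes> e \<otimes> idm y"
    have A: "A \<in> Hom C (y' \<odot> x' \<odot> y' \<odot> y) (y' \<odot> y)"
      using tmor_ide_in_Hom[OF e', of "y' \<odot> y"] by (simp add: A_def tobj_simps tmor_ide)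
    have B: "B \<in> Hom C (y' \<odot> y \<odot> x \<odot> x' \<odot> y' \<odot> y) (y' \<odot> x' \<odot> y' \<odot> y)"
      using ide_tmor_in_Hom[OF tmor_ide_in_Hom[OF tmor_ide_in_Hom[OF e, of "x' \<odot> y'"], of y], of y']
      by (simp add: B_def tobj_simps)
    have D: "D \<in> Hom C (y' \<odot> y \<odot> x \<odot> y) (y' \<odot> y \<odot> x \<odot> x' \<odot> y' \<odot> y)"
      using ide_tmor_in_Hom[OF tmor_ide_in_Hom[OF ide_tmor_in_Hom[OF k', of "y \<odot> x"], of y], of y']
      by (simp add: D_def tobj_simps)
    have F: "F \<in> Hom C (y' \<odot> y) (y' \<odot> y \<odot> x \<odot> y)"
      using ide_tmor_in_Hom[OF ide_tmor_in_Hom[OF k, of y], of y'] by (simp add: F_def tobj_simps)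
    have G: "G \<in> Hom C (y' \<odot> y) (y' \<odot> x' \<odot> y' \<odot> y)"
      using ide_tmor_in_Hom[OF k1, of y'] by (simp add: G_def)
    have H: "H \<in> Hom C (y' \<odot> y \<odot> x \<odot> y) (y' \<odot> y)"
      using ide_tmor_in_Hom[OF tmor_ide_in_Hom[OF e, of y], of y'] by (simp add: H_def tobj_simps)
    have 1: "?E \<otimes> idm (y' \<odot> y) = A \<cdot> B"
    proof -
      have "?E \<otimes> idm (y' \<odot> y) = (e' \<otimes> idm (y' \<odot> y)) \<cdot> ((idm y' \<otimes> e \<otimes> idm x') \<otimes> idm (y' \<odot> y))"
        by (rule comp_tmor_ide[OF e' e2])
      moreover have "e' \<otimes> idm (y' \<odot> y) = A" unfolding A_def by (simp add: tmor_ide)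
      moreover have "(idm y' \<otimes> e \<otimes> idm x') \<otimes> idm (y' \<odot> y) = B"
        unfolding B_def
        using tmor_assoc[OF ide_in_Hom e1 ide_in_Hom] tmor_ide_ide[OF e] by (simp add: tobj_simps)
      ultimately show ?thesis by simp
    qed
    have 2: "idm (y' \<odot> y) \<otimes> ?K = D \<cdot> F"
    proof -
      have "idm (y' \<odot> y) \<otimes> ?K = (idm (y' \<odot> y) \<otimes> idm x \<otimes> k' \<otimes> idm y) \<cdot> (idm (y' \<odot> y) \<otimes> k)"
        by (rule ide_tmor_comp[OF k2 k])
      moreover have "idm (y' \<odot> y) \<otimes> k = F" unfolding F_def using ide_ide_tmor[OF k] by simp
      moreover have "idm (y' \<odot> y) \<otimes> idm x \<otimes> k' \<otimes> idm y = D"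
        unfolding D_def
        using ide_ide_tmor[OF k1] tmor_assoc[OF ide_in_Hom k' ide_in_Hom] by (simp add: tobj_simps)
      ultimately show ?thesis by simp
    qed
    have 3: "B \<cdot> D = G \<cdot> H"
    proof -
      note t1 = tmor_ide_in_Hom[OF e, of "x' \<odot> y'", unfolded tobj_simps]
        and t2 = ide_tmor_in_Hom[OF k', of "y \<odot> x", unfolded tobj_simps]
      have "B \<cdot> D = idm y' \<otimes> ((e \<otimes> idm (x' \<odot> y')) \<cdot> (idm (y \<odot> x) \<otimes> k')) \<otimes> idm y"
        unfolding B_def D_def
        using ide_tmor_comp[OF tmor_ide_in_Hom[OF t1, of y] tmor_ide_in_Hom[OF t2, of y], of y']
          comp_tmor_ide[OF t1 t2, of y] by simp
      also have "\<dots> = idm y' \<otimes> ((k' \<otimes> idm y) \<cdot> (e \<otimes> idm y))"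
        unfolding ke using comp_tmor_ide[OF k' e] by simp
      also have "\<dots> = G \<cdot> H"
        unfolding G_def H_def
        using ide_tmor_comp[OF tmor_ide_in_Hom[OF k'] tmor_ide_in_Hom[OF e]] .
      finally show ?thesis .
    qed
    have 4: "A \<cdot> G = idm (y' \<odot> y)"
      unfolding A_def G_def
      using comp_tmor_ide[OF tmor_ide_in_Hom[OF e', of y', unfolded tobj_simps] ide_tmor_in_Hom[OF k', of y', unfolded tobj_simps], of y]
        snake2' tmor_assoc[OF ide_in_Hom k' ide_in_Hom, of y' y] tmor_assoc[OF e' ide_in_Hom ide_in_Hom, of y' y]
      by (simp add: tmor_ide)
    have 5: "H \<cdot> F = idm (y' \<odot> y)"
      unfolding H_def F_def
      using ide_tmor_comp[OF tmor_ide_in_Hom[OF e, of y, unfolded tobj_simps] ide_tmor_in_Hom[OF k, of y, unfolded tobj_simps], of y']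
        snake2 by (simp add: tmor_ide)
    have "(A \<cdot> B) \<cdot> (D \<cdot> F) = A \<cdot> ((B \<cdot> D) \<cdot> F)"
      using comp_assoc[OF A B comp_in_Hom[OF D F]] comp_assoc[OF B D F] by simp
    also have "\<dots> = (A \<cdot> G) \<cdot> (H \<cdot> F)"
      unfolding 3 using comp_assoc[OF G H F] comp_assoc[OF A G comp_in_Hom[OF H F]] by simp
    also have "\<dots> = idm (y' \<odot> y)" unfolding 4 5 by (rule ide_comp[OF ide_in_Hom])
    finally show ?thesis unfolding 1 2 .
  qed
  show ?thesis
    unfolding dual_pair_def using E K s1 s2 by (simp add: tobj_assoc)
qed

end

section \<open>Chosen duals\<close>

context rigid_tensor_category
begin

lemma dual_pair_rdual: "dual_pair c (rdual C c) (ev C c) (coev C c)"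
  unfolding dual_pair_def using ev_in_Hom coev_in_Hom rdual_snake1 rdual_snake2 by blast

lemma dual_pair_ldual: "dual_pair (ldual C c) c (lev C c) (lcoev C c)"
  unfolding dual_pair_def using lev_in_Hom lcoev_in_Hom ldual_snake1 ldual_snake2 by blast

text \<open>Both are evaluations of right duals of \<open>ldual C c\<close>, and the comparison map
  between these is the identity by the axiom \<open>canonical_rdual_ldual\<close>. Left duality thus
  becomes right duality at the left dual.\<close>

lemma lev_eq_ev: "lev C c = ev C (ldual C c)"
proof -
  have "ev C (ldual C c) \<in> Hom C (c \<odot> ldual C c) \<one>"
    using ev_in_Hom[of "ldual C c"] by (simp add: rdual_ldual)
  from dual_pair_bend(2)[OF dual_pair_ldual this] show ?thesis
    using canonical_rdual_ldual[of c] comp_ide[OF lev_in_Hom[of c]] by (simp add: rdual_ldual tmor_ide)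
qed

lemma lcoev_eq_coev: "lcoev C c = coev C (ldual C c)"
proof (rule dual_pair_unique_coev)
  show "dual_pair (ldual C c) c (ev C (ldual C c)) (coev C (ldual C c))"
    using dual_pair_rdual[of "ldual C c"] by (simp add: rdual_ldual)
  show "dual_pair (ldual C c) c (ev C (ldual C c)) (lcoev C c)"
    using dual_pair_ldual[of c] by (simp add: lev_eq_ev)
qed

text \<open>Exhibits the transpose as the bend of ev_d \<circ> (id \<otimes> f), which makes the
  lemmas on dual pairs applicable to it.\<close>

lemma rdual_mor_eq:
  assumes f: "f \<in> Hom C c d"
  shows "rdual_mor C c d f
    = ((ev C d \<cdot> (idm (rdual C d) \<otimes> f)) \<otimes> idm (rdual C c)) \<cdot> (idm (rdual C d) \<otimes> coev C c)"
proof -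
  note T = ide_tmor_in_Hom[OF f, of "rdual C d"]
  note S = tmor_ide_in_Hom[OF ev_in_Hom[of d], of "rdual C c", unfolded tobj_simps]
    tmor_ide_in_Hom[OF T, of "rdual C c", unfolded tobj_simps]
    ide_tmor_in_Hom[OF coev_in_Hom[of c], of "rdual C d", unfolded tobj_simps]
  show ?thesis
    unfolding rdual_mor_def comp_tmor_ide[OF ev_in_Hom T] comp_assoc[OF S]
    using tmor_assoc[OF ide_in_Hom f ide_in_Hom] by simp
qed

lemma
  assumes f: "f \<in> Hom C c d"
  shows rdual_mor_in_Hom: "rdual_mor C c d f \<in> Hom C (rdual C d) (rdual C c)"
    and ev_rdual_mor: "ev C c \<cdot> (rdual_mor C c d f \<otimes> idm c) = ev C d \<cdot> (idm (rdual C d) \<otimes> f)"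
  unfolding rdual_mor_eq[OF f]
  using dual_pair_bend[OF dual_pair_rdual comp_in_Hom[OF ev_in_Hom ide_tmor_in_Hom[OF f]]] by auto

lemma rdual_mor_comp:
  assumes h: "h \<in> Hom C d e" and f: "f \<in> Hom C c d"
  shows "rdual_mor C c e (h \<cdot> f) = rdual_mor C c d f \<cdot> rdual_mor C d e h"
proof (rule dual_pair_cancel[OF dual_pair_rdual])
  let ?f = "rdual_mor C c d f" and ?h = "rdual_mor C d e h"
  note f' = rdual_mor_in_Hom[OF f] and h' = rdual_mor_in_Hom[OF h]
  show "rdual_mor C c e (h \<cdot> f) \<in> Hom C (rdual C e) (rdual C c)"
    using rdual_mor_in_Hom[OF comp_in_Hom[OF h f]] .
  show "?f \<cdot> ?h \<in> Hom C (rdual C e) (rdual C c)" using comp_in_Hom[OF f' h'] .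
  have "ev C c \<cdot> ((?f \<cdot> ?h) \<otimes> idm c) = (ev C c \<cdot> (?f \<otimes> idm c)) \<cdot> (?h \<otimes> idm c)"
    using comp_tmor_ide[OF f' h'] comp_assoc[OF ev_in_Hom tmor_ide_in_Hom[OF f'] tmor_ide_in_Hom[OF h']]
    by simp
  also have "\<dots> = ev C d \<cdot> ((idm (rdual C d) \<otimes> f) \<cdot> (?h \<otimes> idm c))"
    unfolding ev_rdual_mor[OF f]
    by (rule comp_assoc[OF ev_in_Hom ide_tmor_in_Hom[OF f] tmor_ide_in_Hom[OF h']])
  also have "\<dots> = ev C d \<cdot> ((?h \<otimes> idm d) \<cdot> (idm (rdual C e) \<otimes> f))"
    unfolding tmor_split_left[OF h' f] tmor_split_right[OF h' f] ..
  also have "\<dots> = (ev C d \<cdot> (?h \<otimes> idm d)) \<cdot> (idm (rdual C e) \<otimes> f)"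
    by (rule comp_assoc[OF ev_in_Hom tmor_ide_in_Hom[OF h'] ide_tmor_in_Hom[OF f], symmetric])
  also have "\<dots> = ev C e \<cdot> (idm (rdual C e) \<otimes> (h \<cdot> f))"
    unfolding ev_rdual_mor[OF h] ide_tmor_comp[OF h f]
    by (rule comp_assoc[OF ev_in_Hom ide_tmor_in_Hom[OF h] ide_tmor_in_Hom[OF f]])
  finally show "ev C c \<cdot> (rdual_mor C c e (h \<cdot> f) \<otimes> idm c) = ev C c \<cdot> ((?f \<cdot> ?h) \<otimes> idm c)"
    unfolding ev_rdual_mor[OF comp_in_Hom[OF h f]] by (rule sym)
qed

text \<open>\<open>rdual_tensor\<close> is the comparison map from the nested dual of c \<otimes> d
  to the chosen one, so everything follows from \<open>dual_pair_tensor\<close>.\<close>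

lemma
  shows rdual_tensor_in_Hom: "rdual_tensor C c d \<in> Hom C (rdual C d \<odot> rdual C c) (rdual C (c \<odot> d))"
    and ev_rdual_tensor: "ev C (c \<odot> d) \<cdot> (rdual_tensor C c d \<otimes> idm (c \<odot> d))
      = ev C d \<cdot> (idm (rdual C d) \<otimes> ev C c \<otimes> idm d)"
    and rdual_tensor_is_iso: "is_iso C (rdual C d \<odot> rdual C c) (rdual C (c \<odot> d)) (rdual_tensor C c d)"
proof -
  note d = dual_pair_tensor[OF dual_pair_rdual[of c] dual_pair_rdual[of d]]
  have "ev C d \<cdot> (idm (rdual C d) \<otimes> ev C c \<otimes> idm d) \<in> Hom C ((rdual C d \<odot> rdual C c) \<odot> (c \<odot> d)) \<one>"
    using d unfolding dual_pair_def by blast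
  from dual_pair_bend[OF dual_pair_rdual this] dual_pair_comparison_inverse[OF d dual_pair_rdual]
  show "rdual_tensor C c d \<in> Hom C (rdual C d \<odot> rdual C c) (rdual C (c \<odot> d))"
    and "ev C (c \<odot> d) \<cdot> (rdual_tensor C c d \<otimes> idm (c \<odot> d)) = ev C d \<cdot> (idm (rdual C d) \<otimes> ev C c \<otimes> idm d)"
    and "is_iso C (rdual C d \<odot> rdual C c) (rdual C (c \<odot> d)) (rdual_tensor C c d)"
    unfolding rdual_tensor_def is_iso_def by blast+
qed

section \<open>The dual of the unit, and transposes of evaluation and coevaluation\<close>

lemma ev_unit_in_Hom: "ev C \<one> \<in> Hom C (rdual C \<one>) \<one>"
  using ev_in_Hom[of \<one>] by (simp add: tobj_simps)

lemma coev_unit_in_Hom: "coev C \<one> \<in> Hom C \<one> (rdual C \<one>)"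
  using coev_in_Hom[of \<one>] by (simp add: tobj_simps)

lemma ev_coev_unit: "ev C \<one> \<cdot> coev C \<one> = idm \<one>"
  using rdual_snake1[of \<one>] tmor_unit_left[OF ev_unit_in_Hom] tmor_unit_right[OF coev_unit_in_Hom]
  by simp

lemma coev_ev_unit: "coev C \<one> \<cdot> ev C \<one> = idm (rdual C \<one>)"
proof -
  have "coev C \<one> \<cdot> ev C \<one> = ev C \<one> \<otimes> coev C \<one>"
    using tmor_split_right[OF ev_unit_in_Hom coev_unit_in_Hom] tmor_unit_left[OF coev_unit_in_Hom]
      tmor_unit_right[OF ev_unit_in_Hom] by simp
  also have "\<dots> = idm (rdual C \<one>)"
    using tmor_split_left[OF ev_unit_in_Hom coev_unit_in_Hom] rdual_snake2[of \<one>] by simp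
  finally show ?thesis .
qed

text \<open>The transpose of ev_d is the coevaluation of d^*, up to the identifications of 1 with
  1^* and of duals of products. Paired with d^* \<otimes> d, both sides give ev_d: the left by the
  definition of the transpose, the right by a snake.\<close>

lemma rdual_mor_ev_comp_coev_unit:
  "rdual_mor C (rdual C d \<odot> d) \<one> (ev C d) \<cdot> coev C \<one> = rdual_tensor C (rdual C d) d \<cdot> coev C (rdual C d)"
proof (rule dual_pair_cancel[OF dual_pair_rdual])
  define p where "p = rdual C d"
  define q where "q = rdual C p"
  have ev_d: "ev C d \<in> Hom C (p \<odot> d) \<one>" and ev_p: "ev C p \<in> Hom C (q \<odot> p) \<one>"
    and coev_p: "coev C p \<in> Hom C \<one> (p \<odot> q)"
    unfolding p_def q_def by (rule ev_in_Hom coev_in_Hom)+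
  note evs = rdual_mor_in_Hom[OF ev_d]
  have t: "rdual_tensor C p d \<in> Hom C (p \<odot> q) (rdual C (p \<odot> d))"
    using rdual_tensor_in_Hom[of p d] unfolding q_def p_def by blast
  let ?u = "rdual_mor C (p \<odot> d) \<one> (ev C d) \<cdot> coev C \<one>" and ?v = "rdual_tensor C p d \<cdot> coev C p"
  show "rdual_mor C (rdual C d \<odot> d) \<one> (ev C d) \<cdot> coev C \<one> \<in> Hom C \<one> (rdual C (rdual C d \<odot> d))"
    using comp_in_Hom[OF evs coev_unit_in_Hom] unfolding p_def .
  show "rdual_tensor C (rdual C d) d \<cdot> coev C (rdual C d) \<in> Hom C \<one> (rdual C (rdual C d \<odot> d))"
    using comp_in_Hom[OF t coev_p] unfolding p_def .
  note coev1 = tmor_ide_in_Hom[OF coev_unit_in_Hom, of "p \<odot> d", unfolded tobj_simps]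
  have slide: "(idm (rdual C \<one>) \<otimes> ev C d) \<cdot> (coev C \<one> \<otimes> idm (p \<odot> d)) = coev C \<one> \<cdot> ev C d"
    using tmor_split_right[OF coev_unit_in_Hom ev_d] tmor_split_left[OF coev_unit_in_Hom ev_d]
      tmor_unit_left[OF ev_d] tmor_unit_right[OF coev_unit_in_Hom] by simp
  have "ev C (p \<odot> d) \<cdot> (?u \<otimes> idm (p \<odot> d))
      = (ev C (p \<odot> d) \<cdot> (rdual_mor C (p \<odot> d) \<one> (ev C d) \<otimes> idm (p \<odot> d))) \<cdot> (coev C \<one> \<otimes> idm (p \<odot> d))"
    using comp_tmor_ide[OF evs coev_unit_in_Hom] comp_assoc[OF ev_in_Hom tmor_ide_in_Hom[OF evs] coev1]
    by simp
  also have "\<dots> = ev C \<one> \<cdot> (coev C \<one> \<cdot> ev C d)"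
    unfolding ev_rdual_mor[OF ev_d]
    using comp_assoc[OF ev_unit_in_Hom ide_tmor_in_Hom[OF ev_d, of "rdual C \<one>", unfolded tobj_simps] coev1] slide
    by simp
  also have "\<dots> = ev C d"
    using comp_assoc[OF ev_unit_in_Hom coev_unit_in_Hom ev_d] ide_comp[OF ev_d] by (simp add: ev_coev_unit)
  finally have u: "ev C (p \<odot> d) \<cdot> (?u \<otimes> idm (p \<odot> d)) = ev C d" .
  note coev2 = tmor_ide_in_Hom[OF coev_p, of p, unfolded tobj_simps]
  note coev3 = tmor_ide_in_Hom[OF coev_p, of "p \<odot> d", unfolded tobj_simps]
  note ev2 = ide_tmor_in_Hom[OF ev_p, of p, unfolded tobj_simps]
  note ev3 = tmor_ide_in_Hom[OF ev2, of d, unfolded tobj_simps]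
  have ev4: "(idm p \<otimes> ev C p) \<otimes> idm d = idm p \<otimes> ev C p \<otimes> idm d"
    by (rule tmor_assoc[OF ide_in_Hom ev_p ide_in_Hom])
  have snake: "(idm p \<otimes> ev C p \<otimes> idm d) \<cdot> (coev C p \<otimes> idm (p \<odot> d)) = idm (p \<odot> d)"
    using comp_tmor_ide[OF ev2 coev2, of d] rdual_snake1[of p] tmor_ide_ide[OF coev_p] ev4
    by (simp add: tmor_ide)
  have "ev C (p \<odot> d) \<cdot> (?v \<otimes> idm (p \<odot> d))
      = (ev C (p \<odot> d) \<cdot> (rdual_tensor C p d \<otimes> idm (p \<odot> d))) \<cdot> (coev C p \<otimes> idm (p \<odot> d))"
    using comp_tmor_ide[OF t coev_p]
      comp_assoc[OF ev_in_Hom tmor_ide_in_Hom[OF t, of "p \<odot> d", unfolded tobj_assoc[of p]] coev3]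
    by simp
  also have "\<dots> = ev C d \<cdot> ((idm p \<otimes> ev C p \<otimes> idm d) \<cdot> (coev C p \<otimes> idm (p \<odot> d)))"
    using comp_assoc[OF ev_d ev3 coev3] ev_rdual_tensor[of p d] unfolding ev4 p_def[symmetric] by simp
  also have "\<dots> = ev C d" unfolding snake by (rule comp_ide[OF ev_d])
  finally show "ev C (rdual C d \<odot> d) \<cdot> ((rdual_mor C (rdual C d \<odot> d) \<one> (ev C d) \<cdot> coev C \<one>) \<otimes> idm (rdual C d \<odot> d))
    = ev C (rdual C d \<odot> d) \<cdot> ((rdual_tensor C (rdual C d) d \<cdot> coev C (rdual C d)) \<otimes> idm (rdual C d \<odot> d))"
    using u unfolding p_def by simp
qed

text \<open>Dually, the transpose of a coevaluation is an evaluation: after evaluation at 1 both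
  sides become the evaluation of p^*.\<close>

lemma rdual_mor_coev_comp_rdual_tensor:
  "rdual_mor C \<one> (p \<odot> rdual C p) (coev C p) \<cdot> rdual_tensor C p (rdual C p) = coev C \<one> \<cdot> ev C (rdual C p)"
proof (rule dual_pair_cancel[OF dual_pair_rdual[of \<one>]])
  define q where "q = rdual C p"
  define r where "r = rdual C q"
  have ev_q: "ev C q \<in> Hom C (r \<odot> q) \<one>" and ev_p: "ev C p \<in> Hom C (q \<odot> p) \<one>"
    and coev_p: "coev C p \<in> Hom C \<one> (p \<odot> q)"
    unfolding q_def r_def by (rule ev_in_Hom coev_in_Hom)+
  let ?k = "rdual_mor C \<one> (p \<odot> q) (coev C p)" and ?t = "rdual_tensor C p q"
  note k = rdual_mor_in_Hom[OF coev_p]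
  have t: "?t \<in> Hom C (r \<odot> q) (rdual C (p \<odot> q))"
    using rdual_tensor_in_Hom[of p q] unfolding q_def r_def .
  show "rdual_mor C \<one> (p \<odot> rdual C p) (coev C p) \<cdot> rdual_tensor C p (rdual C p) \<in> Hom C (r \<odot> q) (rdual C \<one>)"
    using comp_in_Hom[OF k t] unfolding q_def .
  show "coev C \<one> \<cdot> ev C (rdual C p) \<in> Hom C (r \<odot> q) (rdual C \<one>)"
    using comp_in_Hom[OF coev_unit_in_Hom ev_q] unfolding q_def .
  note coev2 = ide_tmor_in_Hom[OF coev_p, of "rdual C (p \<odot> q)", unfolded tobj_unit_left tobj_unit_right]
  note coev3 = ide_tmor_in_Hom[OF coev_p, of "r \<odot> q", unfolded tobj_simps]
  note coev4 = ide_tmor_in_Hom[OF coev_p, of q, unfolded tobj_simps]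
  note ev2 = tmor_ide_in_Hom[OF ev_p, of q, unfolded tobj_simps]
  note t2 = tmor_ide_in_Hom[OF t, of "p \<odot> q"]
  have snake: "(idm r \<otimes> ev C p \<otimes> idm q) \<cdot> (idm (r \<odot> q) \<otimes> coev C p) = idm (r \<odot> q)"
    using ide_tmor_comp[OF ev2 coev4, of r] rdual_snake2[of p] ide_ide_tmor[OF coev_p]
    by (simp add: tmor_ide q_def)
  have slide: "(idm (rdual C (p \<odot> q)) \<otimes> coev C p) \<cdot> ?t = (?t \<otimes> idm (p \<odot> q)) \<cdot> (idm (r \<odot> q) \<otimes> coev C p)"
    using tmor_split_right[OF t coev_p] tmor_split_left[OF t coev_p] tmor_unit_right[OF t] by simp
  have "ev C \<one> \<cdot> ((?k \<cdot> ?t) \<otimes> idm \<one>) = (ev C \<one> \<cdot> (?k \<otimes> idm \<one>)) \<cdot> ?t"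
    using tmor_unit_right[OF comp_in_Hom[OF k t]] tmor_unit_right[OF k] comp_assoc[OF ev_unit_in_Hom k t]
    by simp
  also have "\<dots> = ev C (p \<odot> q) \<cdot> ((?t \<otimes> idm (p \<odot> q)) \<cdot> (idm (r \<odot> q) \<otimes> coev C p))"
    unfolding ev_rdual_mor[OF coev_p] using comp_assoc[OF ev_in_Hom coev2 t] slide by simp
  also have "\<dots> = (ev C (p \<odot> q) \<cdot> (?t \<otimes> idm (p \<odot> q))) \<cdot> (idm (r \<odot> q) \<otimes> coev C p)"
    by (rule comp_assoc[OF ev_in_Hom t2 _, symmetric]) (use coev3 in \<open>simp add: tobj_assoc\<close>)
  also have "\<dots> = ev C q \<cdot> ((idm r \<otimes> ev C p \<otimes> idm q) \<cdot> (idm (r \<odot> q) \<otimes> coev C p))"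
    using comp_assoc[OF ev_q ide_tmor_in_Hom[OF ev2, of r] coev3] ev_rdual_tensor[of p q]
    unfolding r_def by simp
  also have "\<dots> = ev C q" unfolding snake by (rule comp_ide[OF ev_q])
  also have "\<dots> = ev C \<one> \<cdot> ((coev C \<one> \<cdot> ev C q) \<otimes> idm \<one>)"
    using tmor_unit_right[OF comp_in_Hom[OF coev_unit_in_Hom ev_q]] ide_comp[OF ev_q]
      comp_assoc[OF ev_unit_in_Hom coev_unit_in_Hom ev_q] by (simp add: ev_coev_unit)
  finally show "ev C \<one> \<cdot> ((rdual_mor C \<one> (p \<odot> rdual C p) (coev C p) \<cdot> rdual_tensor C p (rdual C p)) \<otimes> idm \<one>)
      = ev C \<one> \<cdot> ((coev C \<one> \<cdot> ev C (rdual C p)) \<otimes> idm \<one>)"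
    unfolding q_def .
qed

end

section \<open>Pivotal structures\<close>

context rigid_tensor_category
begin

lemma
  assumes "pivotal_structure C a"
  shows pivotal_iso: "is_iso C c (rdual C (rdual C c)) (a c)"
    and pivotal_in_Hom: "a c \<in> Hom C c (rdual C (rdual C c))"
    and pivotal_natural: "f \<in> Hom C c d \<Longrightarrow>
      rdual_mor C (rdual C d) (rdual C c) (rdual_mor C c d f) \<cdot> a c = a d \<cdot> f"
    and pivotal_tensor: "ften (rddual C) c d \<cdot> (a c \<otimes> a d) = a (c \<odot> d)"
    and pivotal_unit: "a \<one> = rdual_mor C (rdual C \<one>) \<one> (ev C \<one>) \<cdot> coev C \<one>"
proof -
  show iso: "is_iso C c (rdual C (rdual C c)) (a c)" for c
    using assms unfolding pivotal_structure_def monoidal_nat_iso_def id_functor_def rddual_def by simp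
  show "f \<in> Hom C c d \<Longrightarrow> rdual_mor C (rdual C d) (rdual C c) (rdual_mor C c d f) \<cdot> a c = a d \<cdot> f"
    using assms unfolding pivotal_structure_def monoidal_nat_iso_def id_functor_def rddual_def by simp
  show in_Hom: "a c \<in> Hom C c (rdual C (rdual C c))" for c
    using iso unfolding is_iso_def is_inverse_def by blast
  have "ften (rddual C) c d \<cdot> (a c \<otimes> a d) = a (c \<odot> d) \<cdot> idm (c \<odot> d)"
    using assms unfolding pivotal_structure_def monoidal_nat_iso_def id_functor_def by simp
  then show "ften (rddual C) c d \<cdot> (a c \<otimes> a d) = a (c \<odot> d)"
    using comp_ide[OF in_Hom] by simp
  have "a \<one> \<cdot> idm \<one> = fone (rddual C)"
    using assms unfolding pivotal_structure_def monoidal_nat_iso_def id_functor_def by simp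
  then show "a \<one> = rdual_mor C (rdual C \<one>) \<one> (ev C \<one>) \<cdot> coev C \<one>"
    using comp_ide[OF in_Hom] by (simp add: rddual_def)
qed

text \<open>The functor of double right duals carries ev_d to the evaluation of d^{**}. The first
  transpose gives a coevaluation, the second an evaluation; the inverse of
  \<open>rdual_tensor\<close> hidden in \<open>ften\<close> cancels the comparison map produced by
  the first.\<close>

lemma rddual_ev:
  "rdual_mor C (rdual C \<one>) (rdual C (rdual C d \<odot> d)) (rdual_mor C (rdual C d \<odot> d) \<one> (ev C d))
      \<cdot> ften (rddual C) (rdual C d) d
    = (rdual_mor C (rdual C \<one>) \<one> (ev C \<one>) \<cdot> coev C \<one>) \<cdot> ev C (rdual C (rdual C d))"
proof -
  define p where "p = rdual C d"
  define q where "q = rdual C p"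
  have ev_d: "ev C d \<in> Hom C (p \<odot> d) \<one>" and coev_p: "coev C p \<in> Hom C \<one> (p \<odot> q)"
    and ev_q: "ev C q \<in> Hom C (rdual C q \<odot> q) \<one>"
    unfolding p_def q_def by (rule ev_in_Hom coev_in_Hom)+
  let ?t = "rdual_tensor C p d" and ?t' = "rdual_tensor C p q"
  let ?s = "inverse_mor C (p \<odot> q) (rdual C (p \<odot> d)) ?t"
  let ?ev = "rdual_mor C (p \<odot> d) \<one> (ev C d)" and ?e = "rdual_mor C (rdual C \<one>) \<one> (ev C \<one>)"
  let ?k = "rdual_mor C \<one> (p \<odot> q) (coev C p)"
  let ?F = "rdual_mor C (rdual C \<one>) (rdual C (p \<odot> d)) ?ev"
  let ?S = "rdual_mor C (rdual C (p \<odot> d)) (p \<odot> q) ?s"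
  note ev' = rdual_mor_in_Hom[OF ev_d] and e' = rdual_mor_in_Hom[OF ev_unit_in_Hom]
    and k' = rdual_mor_in_Hom[OF coev_p]
  have t: "?t \<in> Hom C (p \<odot> q) (rdual C (p \<odot> d))"
    using rdual_tensor_in_Hom[of p d] unfolding q_def p_def .
  have t': "?t' \<in> Hom C (rdual C q \<odot> q) (rdual C (p \<odot> q))"
    using rdual_tensor_in_Hom[of p q] unfolding q_def .
  have "is_inverse C (p \<odot> q) (rdual C (p \<odot> d)) ?t ?s"
    using is_inverse_inverse_mor rdual_tensor_is_iso[of d p] unfolding q_def p_def by blast
  then have s: "?s \<in> Hom C (rdual C (p \<odot> d)) (p \<odot> q)" and st: "?s \<cdot> ?t = idm (p \<odot> q)"
    unfolding is_inverse_def by auto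
  note F = rdual_mor_in_Hom[OF ev'] and S = rdual_mor_in_Hom[OF s]
  \<comment> \<open>Inserting the identity of 1^* in this form brings the transpose into the shape
    of \<open>rdual_mor_ev_comp_coev_unit\<close>.\<close>
  have "?ev = ?ev \<cdot> (coev C \<one> \<cdot> ev C \<one>)"
    unfolding coev_ev_unit by (rule comp_ide[OF ev', symmetric])
  also have "\<dots> = (?t \<cdot> coev C p) \<cdot> ev C \<one>"
    using comp_assoc[OF ev' coev_unit_in_Hom ev_unit_in_Hom] rdual_mor_ev_comp_coev_unit[of d]
    unfolding p_def by simp
  also have "\<dots> = ?t \<cdot> (coev C p \<cdot> ev C \<one>)"
    by (rule comp_assoc[OF t coev_p ev_unit_in_Hom])
  finally have "?s \<cdot> ?ev = ?s \<cdot> (?t \<cdot> (coev C p \<cdot> ev C \<one>))" by simp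
  also have "\<dots> = coev C p \<cdot> ev C \<one>"
    using comp_assoc[OF s t comp_in_Hom[OF coev_p ev_unit_in_Hom]] st
      ide_comp[OF comp_in_Hom[OF coev_p ev_unit_in_Hom]] by simp
  finally have s_ev: "?s \<cdot> ?ev = coev C p \<cdot> ev C \<one>" .
  \<comment> \<open>The second transpose: dualize both factorizations in \<open>s_ev\<close>, which
    reverses their order.\<close>
  have "?F \<cdot> ?S = ?e \<cdot> ?k"
    using rdual_mor_comp[OF s ev'] rdual_mor_comp[OF coev_p ev_unit_in_Hom] unfolding s_ev by simp
  then have "?F \<cdot> (?S \<cdot> ?t') = ?e \<cdot> (?k \<cdot> ?t')"
    using comp_assoc[OF F S t'] comp_assoc[OF e' k' t'] by simp
  also have "\<dots> = (?e \<cdot> coev C \<one>) \<cdot> ev C q"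
    using rdual_mor_coev_comp_rdual_tensor[of p] comp_assoc[OF e' coev_unit_in_Hom ev_q]
    unfolding q_def by simp
  finally show ?thesis
    unfolding rddual_def p_def q_def by simp
qed

text \<open>By \<open>rddual_ev\<close>, naturality along ev_d combined with monoidality becomes an
  equation whose two sides both end with a_1; this is invertible and cancels.\<close>

lemma ev_pivotal:
  assumes a: "pivotal_structure C a"
  shows "ev C (rdual C (rdual C d)) \<cdot> (a (rdual C d) \<otimes> a d) = ev C d"
proof -
  define p where "p = rdual C d"
  define q where "q = rdual C p"
  have ev_d: "ev C d \<in> Hom C (p \<odot> d) \<one>" and ev_q: "ev C q \<in> Hom C (rdual C q \<odot> q) \<one>"
    unfolding p_def q_def by (rule ev_in_Hom)+
  let ?F = "rdual_mor C (rdual C \<one>) (rdual C (p \<odot> d)) (rdual_mor C (p \<odot> d) \<one> (ev C d))"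
  note F = rdual_mor_in_Hom[OF rdual_mor_in_Hom[OF ev_d]]
  have aa: "a p \<otimes> a d \<in> Hom C (p \<odot> d) (rdual C q \<odot> q)"
    using tmor_in_Hom[OF pivotal_in_Hom[OF a, of p] pivotal_in_Hom[OF a, of d]] unfolding p_def q_def .
  have T: "ften (rddual C) p d \<in> Hom C (rdual C q \<odot> q) (rdual C (rdual C (p \<odot> d)))"
  proof -
    have "inverse_mor C (p \<odot> q) (rdual C (p \<odot> d)) (rdual_tensor C p d) \<in> Hom C (rdual C (p \<odot> d)) (p \<odot> q)"
      using is_inverse_inverse_mor rdual_tensor_is_iso[of d p] unfolding q_def p_def is_inverse_def by blast
    from comp_in_Hom[OF rdual_mor_in_Hom[OF this] rdual_tensor_in_Hom[of p q, folded q_def]]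
    show ?thesis unfolding rddual_def p_def q_def by simp
  qed
  have "a \<one> \<cdot> ev C d = ?F \<cdot> (ften (rddual C) p d \<cdot> (a p \<otimes> a d))"
    using pivotal_natural[OF a ev_d] pivotal_tensor[OF a, of p d] by simp
  also have "\<dots> = (a \<one> \<cdot> ev C q) \<cdot> (a p \<otimes> a d)"
    using comp_assoc[OF F T aa] rddual_ev[of d] pivotal_unit[OF a] unfolding p_def q_def by simp
  also have "\<dots> = a \<one> \<cdot> (ev C q \<cdot> (a p \<otimes> a d))"
    by (rule comp_assoc[OF pivotal_in_Hom[OF a] ev_q aa])
  finally have "ev C d = ev C q \<cdot> (a p \<otimes> a d)"
    by (rule iso_cancel_left[OF pivotal_iso[OF a] ev_d comp_in_Hom[OF ev_q aa]])
  then show ?thesis unfolding p_def q_def by simp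
qed

text \<open>Needed for the right side of the conjugate's equation at d = 1. The trace involves a at
  q = \<open>ldual C \<one>\<close>, about which the unit axiom says nothing directly; the
  isomorphism from 1 to q transports the question to a_1.\<close>

lemma left_trace_unit_mor:
  assumes a: "pivotal_structure C a" and w: "w \<in> Hom C \<one> \<one>"
  shows "ev C \<one> \<cdot> (a (ldual C \<one>) \<otimes> w) \<cdot> lcoev C \<one> = w"
proof -
  define q where "q = ldual C \<one>"
  have rq: "rdual C q = \<one>" unfolding q_def by (rule rdual_ldual)
  let ?i = "rdual_mor C (rdual C \<one>) \<one> (ev C \<one>)"
  let ?j = "coev C q"
  have j: "?j \<in> Hom C \<one> q" using coev_in_Hom[of q] by (simp add: rq tobj_simps)
  have ev_q: "ev C q \<in> Hom C q \<one>" using ev_in_Hom[of q] by (simp add: rq tobj_simps)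
  have ev_j: "ev C q \<cdot> ?j = idm \<one>"
    using rdual_snake2[of q] tmor_unit_right[OF ev_q] tmor_unit_left[OF j] by (simp add: rq)
  have aq: "a q \<in> Hom C q (rdual C \<one>)" using pivotal_in_Hom[OF a, of q] by (simp add: rq)
  note a1 = pivotal_in_Hom[OF a, of \<one>]
  let ?j1 = "rdual_mor C \<one> q ?j"
  let ?j2 = "rdual_mor C (rdual C q) (rdual C \<one>) ?j1"
  have j1: "?j1 \<in> Hom C \<one> (rdual C \<one>)" using rdual_mor_in_Hom[OF j] by (simp add: rq)
  have j1': "?j1 \<in> Hom C (rdual C q) (rdual C \<one>)" using rdual_mor_in_Hom[OF j] .
  \<comment> \<open>Since \<open>coev C \<one>\<close> inverts \<open>ev C \<one>\<close>, this
    identifies the transpose of j with \<open>coev C \<one>\<close>.\<close>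
  have "ev C \<one> \<cdot> ?j1 = idm \<one>"
    using ev_rdual_mor[OF j] tmor_unit_right[OF j1] tmor_unit_left[OF j] ev_j by (simp add: rq)
  then have "coev C \<one> = coev C \<one> \<cdot> (ev C \<one> \<cdot> ?j1)"
    using comp_ide[OF coev_unit_in_Hom] by simp
  also have "\<dots> = ?j1"
    using comp_assoc[OF coev_unit_in_Hom ev_unit_in_Hom j1] ide_comp[OF j1] by (simp add: coev_ev_unit)
  finally have j1_eq: "?j1 = coev C \<one>" by (rule sym)
  have j2: "?j2 \<in> Hom C (rdual C (rdual C \<one>)) (rdual C \<one>)"
    using rdual_mor_in_Hom[OF j1'] by (simp add: rq)
  have i: "?i \<in> Hom C (rdual C \<one>) (rdual C (rdual C \<one>))" using rdual_mor_in_Hom[OF ev_unit_in_Hom] .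
  have ev_j2: "ev C \<one> \<cdot> ?j2 = ev C (rdual C \<one>) \<cdot> (idm (rdual C (rdual C \<one>)) \<otimes> coev C \<one>)"
    using ev_rdual_mor[OF j1'] tmor_unit_right[OF j2] unfolding j1_eq by (simp add: rq j1_eq)
  note R = ide_tmor_in_Hom[OF coev_unit_in_Hom, of "rdual C (rdual C \<one>)", unfolded tobj_simps]
    ide_tmor_in_Hom[OF coev_unit_in_Hom, of "rdual C \<one>", unfolded tobj_simps]
    ide_tmor_in_Hom[OF ev_unit_in_Hom, of "rdual C \<one>", unfolded tobj_simps]
    tmor_ide_in_Hom[OF i, of "rdual C \<one>"]
  have slide: "(idm (rdual C (rdual C \<one>)) \<otimes> coev C \<one>) \<cdot> ?i
      = (?i \<otimes> idm (rdual C \<one>)) \<cdot> (idm (rdual C \<one>) \<otimes> coev C \<one>)"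
    using tmor_split_left[OF i coev_unit_in_Hom] tmor_split_right[OF i coev_unit_in_Hom]
      tmor_unit_right[OF i] by simp
  have id1: "(idm (rdual C \<one>) \<otimes> ev C \<one>) \<cdot> (idm (rdual C \<one>) \<otimes> coev C \<one>) = idm (rdual C \<one>)"
    using ide_tmor_comp[OF ev_unit_in_Hom coev_unit_in_Hom, of "rdual C \<one>"]
    by (simp add: ev_coev_unit tmor_ide tobj_simps)
  have ev_j2_i: "(ev C \<one> \<cdot> ?j2) \<cdot> ?i = ev C \<one>"
  proof -
    have "(ev C \<one> \<cdot> ?j2) \<cdot> ?i = (ev C (rdual C \<one>) \<cdot> (?i \<otimes> idm (rdual C \<one>))) \<cdot> (idm (rdual C \<one>) \<otimes> coev C \<one>)"
      unfolding ev_j2 comp_assoc[OF ev_in_Hom R(1) i] slide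
      by (rule comp_assoc[OF ev_in_Hom R(4) R(2), symmetric])
    also have "\<dots> = ev C \<one> \<cdot> ((idm (rdual C \<one>) \<otimes> ev C \<one>) \<cdot> (idm (rdual C \<one>) \<otimes> coev C \<one>))"
      unfolding ev_rdual_mor[OF ev_unit_in_Hom] by (rule comp_assoc[OF ev_unit_in_Hom R(3,2)])
    also have "\<dots> = ev C \<one>" unfolding id1 by (rule comp_ide[OF ev_unit_in_Hom])
    finally show ?thesis .
  qed
  \<comment> \<open>Naturality along j replaces a_q by a_1, for which the unit axiom gives an
    explicit formula.\<close>
  have "ev C \<one> \<cdot> (a q \<cdot> ?j) = (ev C \<one> \<cdot> ?j2) \<cdot> a \<one>"
    using pivotal_natural[OF a j] comp_assoc[OF ev_unit_in_Hom j2 a1] by simp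
  also have "\<dots> = ev C \<one> \<cdot> coev C \<one>"
    unfolding pivotal_unit[OF a]
    using comp_assoc[OF comp_in_Hom[OF ev_unit_in_Hom j2] i coev_unit_in_Hom] ev_j2_i by simp
  also have "\<dots> = idm \<one>" by (rule ev_coev_unit)
  finally have dim: "ev C \<one> \<cdot> (a q \<cdot> ?j) = idm \<one>" .
  have "(a q \<otimes> w) \<cdot> ?j = (a q \<cdot> ?j) \<cdot> w"
  proof -
    have "(a q \<otimes> w) = a q \<cdot> (idm q \<otimes> w)"
      using tmor_split_left[OF aq w] tmor_unit_right[OF aq] by simp
    moreover have "(idm q \<otimes> w) \<cdot> ?j = ?j \<cdot> w"
      using tmor_split_right[OF j w] tmor_split_left[OF j w] tmor_unit_right[OF j] tmor_unit_left[OF w]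
      by simp
    ultimately show ?thesis
      using comp_assoc[OF aq ide_tmor_in_Hom[OF w, of q, unfolded tobj_simps] j] comp_assoc[OF aq j w] by simp
  qed
  then have "ev C \<one> \<cdot> (a q \<otimes> w) \<cdot> ?j = (ev C \<one> \<cdot> (a q \<cdot> ?j)) \<cdot> w"
    using comp_assoc[OF ev_unit_in_Hom comp_in_Hom[OF aq j] w] by simp
  also have "\<dots> = w" unfolding dim by (rule ide_comp[OF w])
  finally show ?thesis unfolding lcoev_eq_coev q_def .
qed

text \<open>The functional T_c of the overview, kept as an endomorphism of 1 and free of any pivotal
  structure; this lets a, its conjugate and g be compared through the same functional.\<close>

definition ddual_trace :: "'a \<Rightarrow> 'b \<Rightarrow> 'b"
  where "ddual_trace c \<psi> = ev C (rdual C c) \<cdot> (\<psi> \<otimes> idm (rdual C c)) \<cdot> coev C c"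

lemma ddual_trace_in_Hom:
  assumes "\<psi> \<in> Hom C c (rdual C (rdual C c))"
  shows "ddual_trace c \<psi> \<in> Hom C \<one> \<one>"
  unfolding ddual_trace_def
  using comp_in_Hom[OF ev_in_Hom comp_in_Hom[OF tmor_ide_in_Hom[OF assms] coev_in_Hom]] .

lemma canonical_in_Hom:
  assumes "canonical_ddual_iso C g"
  shows "g c \<in> Hom C (ldual C (ldual C c)) (rdual C (rdual C c))"
  using assms
  unfolding canonical_ddual_iso_def monoidal_nat_iso_def lddual_def rddual_def is_iso_def is_inverse_def
  by auto

text \<open>For d the double left dual of c one has d^* = \<open>ldual C c\<close> and d^{**} = c.
  Write f as a_d \<circ> s \<circ> f; then \<open>ev_pivotal\<close> absorbs both occurrences of a
  and leaves ev_d, which is the left evaluation occurring in the equation for g.\<close>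

lemma left_trace_mor_eq:
  assumes a: "pivotal_structure C a" and g: "canonical_ddual_iso C g" and f: "f \<in> Hom C c c"
    and inv: "is_inverse C (ldual C (ldual C c)) c (a (ldual C (ldual C c))) s"
  shows "ev C c \<cdot> (a (ldual C c) \<otimes> f) \<cdot> lcoev C c = ddual_trace c (g c \<cdot> (s \<cdot> f))"
proof -
  define d where "d = ldual C (ldual C c)"
  define p where "p = ldual C c"
  have rd: "rdual C d = p" "rdual C p = c" unfolding d_def p_def by (simp_all add: rdual_ldual)
  have s: "s \<in> Hom C c d" and as: "a d \<cdot> s = idm c"
    using inv unfolding is_inverse_def d_def by auto
  have ad: "a d \<in> Hom C d c" and ap: "a p \<in> Hom C p (rdual C c)"
    using pivotal_in_Hom[OF a, of d] pivotal_in_Hom[OF a, of p] by (simp_all add: rd)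
  have ev_c: "ev C c \<in> Hom C (rdual C c \<odot> c) \<one>" by (rule ev_in_Hom)
  note sf = comp_in_Hom[OF s f]
  have "a d \<cdot> (s \<cdot> f) = f" using comp_assoc[OF ad s f] as ide_comp[OF f] by simp
  then have "a p \<otimes> f = (a p \<otimes> a d) \<cdot> (idm p \<otimes> (s \<cdot> f))"
    using tmor_comp[OF ap ide_in_Hom ad sf] comp_ide[OF ap] by simp
  then have "ev C c \<cdot> (a p \<otimes> f) = (ev C c \<cdot> (a p \<otimes> a d)) \<cdot> (idm p \<otimes> (s \<cdot> f))"
    using comp_assoc[OF ev_c tmor_in_Hom[OF ap ad] ide_tmor_in_Hom[OF sf]] by simp
  then have ev_a: "ev C c \<cdot> (a p \<otimes> f) = ev C d \<cdot> (idm p \<otimes> (s \<cdot> f))"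
    using ev_pivotal[OF a, of d] by (simp add: rd)
  have ev_d: "ev C d \<in> Hom C (p \<odot> d) \<one>" and k: "lcoev C c \<in> Hom C \<one> (p \<odot> c)"
    using ev_in_Hom[of d] lcoev_in_Hom[of c] by (simp_all add: rd p_def)
  have "ev C c \<cdot> (a p \<otimes> f) \<cdot> lcoev C c = ev C d \<cdot> (idm p \<otimes> (s \<cdot> f)) \<cdot> lcoev C c"
    using comp_assoc[OF ev_c tmor_in_Hom[OF ap f] k] comp_assoc[OF ev_d ide_tmor_in_Hom[OF sf] k] ev_a
    by simp
  \<comment> \<open>The identity is inserted to play the part of h in the equation for g, taken at x
    = c.\<close>
  also have "\<dots> = lev C p \<cdot> (idm p \<otimes> ((s \<cdot> f) \<cdot> idm c)) \<cdot> lcoev C c"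
    unfolding lev_eq_ev comp_ide[OF sf] d_def p_def ..
  also have "\<dots> = ddual_trace c (g c \<cdot> (s \<cdot> f) \<cdot> idm c)"
  proof -
    have "\<forall>f \<in> Hom C c (ldual C (ldual C c)). \<forall>h \<in> Hom C c c.
      ddual_trace c (g c \<cdot> f \<cdot> h) = lev C (ldual C c) \<cdot> (idm (ldual C c) \<otimes> (f \<cdot> h)) \<cdot> lcoev C c"
      using g unfolding canonical_ddual_iso_def ddual_trace_def by blast
    then show ?thesis using sf ide_in_Hom unfolding d_def p_def by metis
  qed
  also have "\<dots> = ddual_trace c (g c \<cdot> (s \<cdot> f))" unfolding comp_ide[OF sf] ..
  finally show ?thesis unfolding p_def .
qed

end

section \<open>Nondegeneracy of the trace pairing and the two statements on pivotal
  structures\<close>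

context fusion_category
begin

text \<open>
  A nonzero morphism $c \otimes c^{*} \to 1$ splits, and by rigidity its section is bent from an
  endomorphism of \<open>c\<close>; so no dimensions of simple objects enter.
\<close>

lemma ddual_trace_nondegenerate:
  assumes \<psi>: "\<psi> \<in> Hom C c (rdual C (rdual C c))" and \<chi>: "\<chi> \<in> Hom C c (rdual C (rdual C c))"
    and eq: "\<And>f. f \<in> Hom C c c \<Longrightarrow> ddual_trace c (\<psi> \<cdot> f) = ddual_trace c (\<chi> \<cdot> f)"
  shows "\<psi> = \<chi>"
proof (rule dual_pair_cancel[OF dual_pair_rdual \<psi> \<chi>])
  let ?ev = "\<lambda>\<psi>. ev C (rdual C c) \<cdot> (\<psi> \<otimes> idm (rdual C c))"
  have in_Hom: "?ev \<psi> \<in> Hom C (c \<odot> rdual C c) \<one>" if "\<psi> \<in> Hom C c (rdual C (rdual C c))" for \<psi>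
    using comp_in_Hom[OF ev_in_Hom tmor_ide_in_Hom[OF that]] .
  have trace: "?ev \<psi> \<cdot> ((f \<otimes> idm (rdual C c)) \<cdot> coev C c) = ddual_trace c (\<psi> \<cdot> f)"
    if \<psi>: "\<psi> \<in> Hom C c (rdual C (rdual C c))" and f: "f \<in> Hom C c c" for \<psi> f
  proof -
    note T = tmor_ide_in_Hom[OF \<psi>, of "rdual C c"] tmor_ide_in_Hom[OF f, of "rdual C c"]
    show ?thesis
      unfolding ddual_trace_def comp_tmor_ide[OF \<psi> f]
        comp_assoc[OF ev_in_Hom T(1) comp_in_Hom[OF T(2) coev_in_Hom]] comp_assoc[OF T coev_in_Hom] ..
  qed
  show "?ev \<psi> = ?ev \<chi>"
  proof (rule ccontr)
    assume "?ev \<psi> \<noteq> ?ev \<chi>"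
    then have "?ev \<psi> - ?ev \<chi> \<noteq> 0" by simp
    then obtain v where v: "v \<in> Hom C \<one> (c \<odot> rdual C c)" and split: "(?ev \<psi> - ?ev \<chi>) \<cdot> v = idm \<one>"
      using nonzero_to_unit_splits[OF subspace_diff[OF Hom_subspace in_Hom[OF \<psi>] in_Hom[OF \<chi>]]] by blast
    obtain f where f: "f \<in> Hom C c c" "v = (f \<otimes> idm (rdual C c)) \<cdot> coev C c"
      using dual_pair_bend_coev[OF dual_pair_rdual v] by blast
    \<comment> \<open>The section v comes from an endomorphism f, and on f the two functionals agree
      by hypothesis.\<close>
    have "(?ev \<psi> - ?ev \<chi>) \<cdot> v = 0"
      using comp_diff_left[OF in_Hom[OF \<psi>] in_Hom[OF \<chi>] v] eq[OF f(1)]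
        trace[OF \<psi> f(1)] trace[OF \<chi> f(1)] f(2) by simp
    then have "idm \<one> = 0" using split by simp
    then show False using simple_unit is_zero_obj_iff unfolding is_simple_def by blast
  qed
qed

text \<open>The equivalence holds for each object c separately: both traces are values of T_c, on
  g_c \<circ> s \<circ> f and a_c \<circ> f, and nondegeneracy removes f.\<close>

lemma spherical_iff_canonical:
  assumes a: "pivotal_structure C a" and g: "canonical_ddual_iso C g"
  shows "spherical C a \<longleftrightarrow> (\<forall>c. a c \<cdot> a (ldual C (ldual C c)) = g c)"
proof -
  have "(\<forall>f \<in> Hom C c c. left_trace C a c f = right_trace C a c f)
      \<longleftrightarrow> a c \<cdot> a (ldual C (ldual C c)) = g c" for c
  proof -
    define d where "d = ldual C (ldual C c)"
    have "is_iso C d c (a d)"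
      using pivotal_iso[OF a, of d] unfolding d_def by (simp add: rdual_ldual)
    then obtain s where inv: "is_inverse C d c (a d) s" unfolding is_iso_def by blast
    then have s: "s \<in> Hom C c d" and ad: "a d \<in> Hom C d c"
      and sa: "s \<cdot> a d = idm d" and as: "a d \<cdot> s = idm c"
      unfolding is_inverse_def by auto
    have gc: "g c \<in> Hom C d (rdual C (rdual C c))"
      using canonical_in_Hom[OF g] unfolding d_def .
    note gs = comp_in_Hom[OF gc s] and ac = pivotal_in_Hom[OF a, of c]
    have traces: "left_trace C a c f = right_trace C a c f
        \<longleftrightarrow> ddual_trace c ((g c \<cdot> s) \<cdot> f) = ddual_trace c (a c \<cdot> f)" if f: "f \<in> Hom C c c" for f
    proof -
      have "left_trace C a c f = scalar_of C (ddual_trace c ((g c \<cdot> s) \<cdot> f))"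
        unfolding left_trace_def left_trace_mor_eq[OF a g f inv[unfolded d_def]] comp_assoc[OF gc s f] ..
      moreover have "right_trace C a c f = scalar_of C (ddual_trace c (a c \<cdot> f))"
        unfolding right_trace_def ddual_trace_def ..
      ultimately show ?thesis
        using scalar_of_eq_iff[OF ddual_trace_in_Hom[OF comp_in_Hom[OF gs f]]
            ddual_trace_in_Hom[OF comp_in_Hom[OF ac f]]] by simp
    qed
    have "g c \<cdot> s = a c \<longleftrightarrow> a c \<cdot> a d = g c"
    proof
      assume "g c \<cdot> s = a c"
      then have "a c \<cdot> a d = g c \<cdot> (s \<cdot> a d)" using comp_assoc[OF gc s ad] by simp
      then show "a c \<cdot> a d = g c" unfolding sa comp_ide[OF gc] .
    next
      assume "a c \<cdot> a d = g c"
      then have "g c \<cdot> s = a c \<cdot> (a d \<cdot> s)" using comp_assoc[OF ac ad s] by simp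
      then show "g c \<cdot> s = a c" unfolding as comp_ide[OF ac] .
    qed
    moreover have "(\<forall>f \<in> Hom C c c. left_trace C a c f = right_trace C a c f) \<longleftrightarrow> g c \<cdot> s = a c"
      using traces ddual_trace_nondegenerate[OF gs ac] by metis
    ultimately show ?thesis unfolding d_def by simp
  qed
  then show ?thesis unfolding spherical_def by simp
qed

text \<open>The defining property of the conjugate is used with $d = 1$ and $h = \mathrm{id}$ only.\<close>

lemma conjugate_comp_pivotal:
  assumes a: "pivotal_structure C a" and g: "canonical_ddual_iso C g" and b: "conjugate_pivotal C a b"
  shows "b c \<cdot> a (ldual C (ldual C c)) = g c"
proof -
  have b_piv: "pivotal_structure C b" using b unfolding conjugate_pivotal_def by simp
  define d where "d = ldual C (ldual C c)"
  \<comment> \<open>For this x the double left dual is c, so the inverse in the conjugate's equation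
    is that of b_c.\<close>
  define x where "x = rdual C (rdual C c)"
  have lx: "ldual C x = rdual C c" "ldual C (rdual C c) = c" unfolding x_def by (simp_all add: ldual_rdual)
  have "is_iso C d c (a d)"
    using pivotal_iso[OF a, of d] unfolding d_def by (simp add: rdual_ldual)
  then obtain s where inv: "is_inverse C d c (a d) s" unfolding is_iso_def by blast
  then have s: "s \<in> Hom C c d" and ad: "a d \<in> Hom C d c" and sa: "s \<cdot> a d = idm d"
    unfolding is_inverse_def by auto
  have gc: "g c \<in> Hom C d x" using canonical_in_Hom[OF g] unfolding d_def x_def .
  note gs = comp_in_Hom[OF gc s]
  have bc: "b c \<in> Hom C c x" using pivotal_in_Hom[OF b_piv] unfolding x_def .
  let ?t = "inverse_mor C c x (b c)"
  have "is_inverse C c x (b c) ?t"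
    using is_inverse_inverse_mor pivotal_iso[OF b_piv] unfolding x_def by blast
  then have t: "?t \<in> Hom C x c" and tb: "?t \<cdot> b c = idm c" unfolding is_inverse_def by auto
  have "ddual_trace c ((g c \<cdot> s) \<cdot> f) = ddual_trace c (b c \<cdot> f)" if f: "f \<in> Hom C c c" for f
  proof -
    note bf = comp_in_Hom[OF bc f]
    have tbf: "?t \<cdot> (b c \<cdot> f) = f" using comp_assoc[OF t bc f] tb ide_comp[OF f] by simp
    have bf': "b c \<cdot> f \<in> Hom C c (\<one> \<odot> x)" and id': "idm c \<in> Hom C (\<one> \<odot> ldual C (ldual C x)) c"
      using bf ide_in_Hom[of c] by (simp_all add: tobj_simps lx)
    \<comment> \<open>The first morphism in the defining equation is taken to be b_c \<circ> f: on
      the left b_c cancels and the left trace of f remains, on the right T_c of b_c \<circ> f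
      appears.\<close>
    have "left_trace C a c
        (idm c \<cdot> (idm \<one> \<otimes> inverse_mor C (ldual C (ldual C x)) x (b (ldual C (ldual C x)))) \<cdot> (b c \<cdot> f))
      = left_trace C a \<one>
        ((idm \<one> \<otimes> lev C x) \<cdot> (((b c \<cdot> f) \<cdot> idm c) \<otimes> idm (ldual C x)) \<cdot> (idm \<one> \<otimes> lcoev C (ldual C x)))"
      using b bf' id' unfolding conjugate_pivotal_def by blast
    moreover have "idm \<one> \<otimes> inverse_mor C (ldual C (ldual C x)) x (b (ldual C (ldual C x))) = ?t"
      unfolding lx by (rule tmor_unit_left[OF t])
    moreover have "idm c \<cdot> (?t \<cdot> (b c \<cdot> f)) = f" unfolding tbf by (rule ide_comp[OF f])
    moreover have "idm \<one> \<otimes> lev C x = ev C (rdual C c)"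
      using tmor_unit_left[OF lev_in_Hom[of x]] by (simp add: lev_eq_ev lx)
    moreover have "idm \<one> \<otimes> lcoev C (ldual C x) = coev C c"
      using tmor_unit_left[OF lcoev_in_Hom[of "ldual C x"]] by (simp add: lcoev_eq_coev lx)
    moreover have "(b c \<cdot> f) \<cdot> idm c = b c \<cdot> f" by (rule comp_ide[OF bf])
    ultimately have eq: "left_trace C a c f = left_trace C a \<one> (ddual_trace c (b c \<cdot> f))"
      unfolding ddual_trace_def by (simp add: lx)
    have bf_x: "ddual_trace c (b c \<cdot> f) \<in> Hom C \<one> \<one>"
      using ddual_trace_in_Hom bf unfolding x_def .
    have gsf_x: "ddual_trace c ((g c \<cdot> s) \<cdot> f) \<in> Hom C \<one> \<one>"
      using ddual_trace_in_Hom comp_in_Hom[OF gs f] unfolding x_def .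
    have "left_trace C a c f = scalar_of C (ddual_trace c ((g c \<cdot> s) \<cdot> f))"
      unfolding left_trace_def left_trace_mor_eq[OF a g f inv[unfolded d_def]] comp_assoc[OF gc s f] ..
    moreover have "left_trace C a \<one> (ddual_trace c (b c \<cdot> f)) = scalar_of C (ddual_trace c (b c \<cdot> f))"
      unfolding left_trace_def left_trace_unit_mor[OF a bf_x] ..
    ultimately show ?thesis using eq scalar_of_eq_iff[OF gsf_x bf_x] by simp
  qed
  then have "g c \<cdot> s = b c"
    using ddual_trace_nondegenerate gs bc unfolding x_def by blast
  then have "b c \<cdot> a d = g c \<cdot> (s \<cdot> a d)" using comp_assoc[OF gc s ad] by simp
  then show ?thesis using comp_ide[OF gc] unfolding sa by (simp add: d_def)
qed

text \<open>Let d be the double left dual of c. Naturality of a along its own component a_d, with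
  a_d cancelled, shows that the double dual of a_d is a_c. Naturality of b along a_d is then the
  claim.\<close>

lemma pivotal_comp_commute:
  assumes a: "pivotal_structure C a" and b: "pivotal_structure C b"
  shows "a c \<cdot> b (ldual C (ldual C c)) = b c \<cdot> a (ldual C (ldual C c))"
proof -
  define d where "d = ldual C (ldual C c)"
  have rd: "rdual C (rdual C d) = c" unfolding d_def by (simp add: rdual_ldual)
  have ad: "a d \<in> Hom C d c" and iso: "is_iso C d c (a d)"
    using pivotal_in_Hom[OF a, of d] pivotal_iso[OF a, of d] by (simp_all add: rd)
  let ?a = "rdual_mor C (rdual C c) (rdual C d) (rdual_mor C d c (a d))"
  have "?a \<in> Hom C c (rdual C (rdual C c))"
    using rdual_mor_in_Hom[OF rdual_mor_in_Hom[OF ad]] by (simp add: rd)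
  moreover have "?a \<cdot> a d = a c \<cdot> a d" by (rule pivotal_natural[OF a ad])
  ultimately have "?a = a c"
    using iso_cancel_right[OF iso _ pivotal_in_Hom[OF a]] by blast
  then show ?thesis using pivotal_natural[OF b ad] unfolding d_def by simp
qed

end

theorem proposition4p10:
  fixes C :: "('o, 'm::ab_group_add) tensor_cat" and a g :: "'o \<Rightarrow> 'm"
  assumes "fusion_category C"
    and "pivotal_structure C a"
    and "canonical_ddual_iso C g"
  shows "(\<forall>abar. conjugate_pivotal C a abar \<longrightarrow>
            (\<forall>c. abar c \<cdot>\<^bsub>C\<^esub> a (ldual C (ldual C c)) = g c \<and>
                 a c \<cdot>\<^bsub>C\<^esub> abar (ldual C (ldual C c)) = g c))
       \<and> (spherical C a \<longleftrightarrow> (\<forall>c. a c \<cdot>\<^bsub>C\<^esub> a (ldual C (ldual C c)) = g c))"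
proof -
  interpret fusion_category C by fact
  show ?thesis
    \<comment> \<open>A conjugate is pivotal by definition, so commutation reduces the second
      composite in (i) to the first.\<close>
    using conjugate_comp_pivotal[OF assms(2,3)] pivotal_comp_commute[OF assms(2)]
      spherical_iff_canonical[OF assms(2,3)]
    unfolding conjugate_pivotal_def by (metis (no_types))
qed

end
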